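(* $v_4(2)\le 9126$.
   Context: For a prime $p$ and an integer $d\ge 1$, $v_d(p)$ denotes the largest integer $n$ for which there exists a form of degree $d$ in $n$ variables with coefficients in $\mathbb{Q}_p$ whose only zero in $\mathbb{Q}_p^n$ is the trivial one. Equivalently, every form of degree $d$ over $\mathbb{Q}_p$ in more than $v_d(p)$ variables has a non-trivial $p$-adic zero. *)

theory Defs
  imports
    "Berlekamp_Zassenhaus.Finite_Field"
    "HOL-Computational_Algebra.Fraction_Field"
    "HOL-Library.Extended_Nat"
    "HOL-Library.Numeral_Type"
    "HOL-Library.Poly_Mapping"
begin

section \<open>The field of p-adic numbers\<close>

text \<open>
  The prime \<open>p\<close> is carried by a type: \<open>p = CARD('p)\<close> with \<open>'p :: prime_card\<close>. The numeral
  type \<open>2\<close> stands for the prime 2.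
\<close>

instance bit0 :: (CARD_1) prime_card
  by standard (auto simp: CARD_1)

text \<open>
  The ring of p-adic integers is the inverse limit of the rings \<open>\<int>/p^n\<close>; residue classes
  are represented by their representatives in \<open>{0..<p^n}\<close>. The single equation below states both
  that \<open>f n\<close> is a reduced representative and that \<open>f (Suc n)\<close> is mapped to \<open>f n\<close>.
\<close>

typedef (overloaded) 'p padic_int =
  "{f :: nat \<Rightarrow> int. \<forall>n. f n = f (Suc n) mod int CARD('p :: prime_card) ^ n}"
  by (rule exI[of _ "\<lambda>_. 0"]) simp

setup_lifting type_definition_padic_int

lemma mod_power_Suc_mod_power: "(x mod p ^ Suc n) mod p ^ n = x mod p ^ n" for x p :: int
  by (rule mod_mod_cancel) (simp add: le_imp_power_dvd)

lemma padic_int_mod_self: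
  fixes f :: "nat \<Rightarrow> int"
  assumes "\<forall>n. f n = f (Suc n) mod p ^ n"
  shows "f n mod p ^ n = f n"
proof -
  have "f n = f (Suc n) mod p ^ n"
    using assms by (rule spec)
  thus ?thesis
    by simp
qed

instantiation padic_int :: (prime_card) comm_ring_1
begin

lift_definition zero_padic_int :: "'a padic_int" is "\<lambda>_. 0"
  by simp

lift_definition one_padic_int :: "'a padic_int" is "\<lambda>n. 1 mod int CARD('a) ^ n"
  by (simp only: mod_power_Suc_mod_power)

lift_definition plus_padic_int :: "'a padic_int \<Rightarrow> 'a padic_int \<Rightarrow> 'a padic_int"
  is "\<lambda>f g n. (f n + g n) mod int CARD('a) ^ n"
proof -
  fix f g :: "nat \<Rightarrow> int" and n
  assume f: "\<And>n. f n = f (Suc n) mod int CARD('a) ^ n" and g: "\<And>n. g n = g (Suc n) mod int CARD('a) ^ n"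
  show "(f n + g n) mod int CARD('a) ^ n =
      (f (Suc n) + g (Suc n)) mod int CARD('a) ^ Suc n mod int CARD('a) ^ n"
    by (simp only: mod_power_Suc_mod_power mod_add_eq f[of n] g[of n])
qed

lift_definition times_padic_int :: "'a padic_int \<Rightarrow> 'a padic_int \<Rightarrow> 'a padic_int"
  is "\<lambda>f g n. (f n * g n) mod int CARD('a) ^ n"
proof -
  fix f g :: "nat \<Rightarrow> int" and n
  assume f: "\<And>n. f n = f (Suc n) mod int CARD('a) ^ n" and g: "\<And>n. g n = g (Suc n) mod int CARD('a) ^ n"
  show "(f n * g n) mod int CARD('a) ^ n =
      (f (Suc n) * g (Suc n)) mod int CARD('a) ^ Suc n mod int CARD('a) ^ n"
    by (simp only: mod_power_Suc_mod_power mod_mult_eq f[of n] g[of n])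
qed

lift_definition uminus_padic_int :: "'a padic_int \<Rightarrow> 'a padic_int"
  is "\<lambda>f n. (- f n) mod int CARD('a) ^ n"
proof -
  fix f :: "nat \<Rightarrow> int" and n
  assume f: "\<And>n. f n = f (Suc n) mod int CARD('a) ^ n"
  show "(- f n) mod int CARD('a) ^ n =
      (- f (Suc n)) mod int CARD('a) ^ Suc n mod int CARD('a) ^ n"
    by (simp only: mod_power_Suc_mod_power mod_minus_eq f[of n])
qed

lift_definition minus_padic_int :: "'a padic_int \<Rightarrow> 'a padic_int \<Rightarrow> 'a padic_int"
  is "\<lambda>f g n. (f n - g n) mod int CARD('a) ^ n"
proof -
  fix f g :: "nat \<Rightarrow> int" and n
  assume f: "\<And>n. f n = f (Suc n) mod int CARD('a) ^ n" and g: "\<And>n. g n = g (Suc n) mod int CARD('a) ^ n"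
  show "(f n - g n) mod int CARD('a) ^ n =
      (f (Suc n) - g (Suc n)) mod int CARD('a) ^ Suc n mod int CARD('a) ^ n"
    by (simp only: mod_power_Suc_mod_power mod_diff_eq f[of n] g[of n])
qed

instance
proof
  fix a b c :: "'a padic_int"
  show "a * b * c = a * (b * c)"
    by transfer (simp (no_asm) only: mod_simps mult.assoc)
  show "a * b = b * a"
    by transfer (simp (no_asm) only: mult.commute)
  show "1 * a = a"
    by transfer (rule ext, simp (no_asm) only: mod_mult_left_eq mult_1, rule padic_int_mod_self)
  show "a + b + c = a + (b + c)"
    by transfer (simp (no_asm) only: mod_simps add.assoc)
  show "a + b = b + a"
    by transfer (simp (no_asm) only: add.commute)
  show "0 + a = a"
    by transfer (rule ext, simp (no_asm) only: add_0, rule padic_int_mod_self)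
  show "- a + a = 0"
    by transfer (simp (no_asm) only: mod_simps add.left_inverse mod_0)
  show "a - b = a + - b"
    by transfer (simp (no_asm) only: mod_simps diff_conv_add_uminus)
  show "(a + b) * c = a * c + b * c"
    by transfer (simp (no_asm) only: mod_simps distrib_right)
  show "(0 :: 'a padic_int) \<noteq> 1"
  proof transfer
    have "1 < int CARD('a)"
      using prime_card_int by (rule prime_gt_1_int)
    thus "(\<lambda>_. 0) \<noteq> (\<lambda>n. 1 mod int CARD('a) ^ n)"
      by (auto dest!: fun_cong[of _ _ 1])
  qed
qed

end

lemma padic_int_reduce:
  fixes f :: "nat \<Rightarrow> int"
  assumes "\<forall>n. f n = f (Suc n) mod p ^ n"
  shows "f n = f (n + k) mod p ^ n"
proof (induction k)
  case 0
  show ?case using padic_int_mod_self[OF assms] by simp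
next
  case (Suc k)
  have "f (n + k) mod p ^ n = (f (Suc (n + k)) mod p ^ (n + k)) mod p ^ n"
    using spec[OF assms, of "n + k"] by (rule arg_cong)
  also have "\<dots> = f (Suc (n + k)) mod p ^ n"
    by (rule mod_mod_cancel) (simp add: le_imp_power_dvd)
  finally show ?case using Suc by (simp only: add_Suc_right)
qed

instance padic_int :: (prime_card) idom
proof
  fix a b :: "'a padic_int"
  assume "a \<noteq> 0" "b \<noteq> 0"
  thus "a * b \<noteq> 0"
  proof (transfer, safe)
    fix f g :: "nat \<Rightarrow> int"
    let ?p = "int CARD('a)"
    assume f: "\<forall>n. f n = f (Suc n) mod ?p ^ n" and g: "\<forall>n. g n = g (Suc n) mod ?p ^ n"
    assume "f \<noteq> (\<lambda>_. 0)" "g \<noteq> (\<lambda>_. 0)"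
    then obtain m n where mn: "f m \<noteq> 0" "g n \<noteq> 0"
      by (auto simp: fun_eq_iff)
    assume "(\<lambda>n. f n * g n mod ?p ^ n) = (\<lambda>_. 0)"
    hence "?p ^ (m + n) dvd f (m + n) * g (m + n)"
      by (simp only: fun_eq_iff mod_eq_0_iff_dvd)
    then obtain i j where ij: "i + j = m + n" "?p ^ i dvd f (m + n)" "?p ^ j dvd g (m + n)"
      using prime_elem_power_dvd_prod[of ?p "m + n"] prime_card_int[where 'a = 'a]
      by (meson prime_imp_prime_elem)
    have "m \<le> i \<or> n \<le> j"
      using ij(1) by linarith
    hence "?p ^ m dvd f (m + n) \<or> ?p ^ n dvd g (m + n)"
      using power_le_dvd[OF ij(2)] power_le_dvd[OF ij(3)] by (elim disjE) simp_all
    hence "f (m + n) mod ?p ^ m = 0 \<or> g (n + m) mod ?p ^ n = 0"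
      by (simp only: mod_eq_0_iff_dvd add.commute[of n m])
    thus False
      using mn by (simp only: padic_int_reduce[OF f, of m n, symmetric]
        padic_int_reduce[OF g, of n m, symmetric] simp_thms)
  qed
qed

type_synonym 'p padic = "'p padic_int fract"

section \<open>Forms\<close>

text \<open>
  A polynomial in the variables \<open>X\<^sub>0, X\<^sub>1, \<dots>\<close> is a finitely supported map from exponent vectors to
  coefficients.
\<close>

type_synonym 'a mpoly = "(nat \<Rightarrow>\<^sub>0 nat) \<Rightarrow>\<^sub>0 'a"

definition mpoly_eval :: "'a :: comm_semiring_1 mpoly \<Rightarrow> (nat \<Rightarrow> 'a) \<Rightarrow> 'a" where
  "mpoly_eval F x = (\<Sum>m\<in>Poly_Mapping.keys F. Poly_Mapping.lookup F m *
     (\<Prod>i\<in>Poly_Mapping.keys m. x i ^ Poly_Mapping.lookup m i))"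

definition is_form :: "nat \<Rightarrow> nat \<Rightarrow> 'a :: zero mpoly \<Rightarrow> bool" where
  "is_form d n F \<longleftrightarrow> (\<forall>m\<in>Poly_Mapping.keys F.
     Poly_Mapping.keys m \<subseteq> {..<n} \<and> (\<Sum>i\<in>Poly_Mapping.keys m. Poly_Mapping.lookup m i) = d)"

text \<open>
  A point of \<open>K\<^sup>n\<close> is given by the first \<open>n\<close> values of a function on \<open>nat\<close>; the remaining values do
  not affect a form in \<open>n\<close> variables.
\<close>

definition only_trivial_zero :: "nat \<Rightarrow> 'a :: comm_semiring_1 mpoly \<Rightarrow> bool" where
  "only_trivial_zero n F \<longleftrightarrow> (\<forall>x. mpoly_eval F x = 0 \<longrightarrow> (\<forall>i<n. x i = 0))"

section \<open>The invariant \<open>v\<^sub>d(p)\<close>\<close>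

definition anisotropic_dims :: "nat \<Rightarrow> 'p :: prime_card itself \<Rightarrow> nat set" where
  "anisotropic_dims d _ = {n. \<exists>F :: 'p padic mpoly. is_form d n F \<and> only_trivial_zero n F}"

text \<open>
  The value is taken in \<open>enat\<close>, where the supremum is the maximum if there is one and \<open>\<infinity>\<close> otherwise
  (see \<open>v_form_eq_enat_iff\<close>), so that a finite upper bound on it entails that the maximum exists.
\<close>

definition v_form :: "nat \<Rightarrow> 'p :: prime_card itself \<Rightarrow> enat" where
  "v_form d p = (SUP n\<in>anisotropic_dims d p. enat n)"

lemma zero_in_anisotropic_dims: "0 \<in> anisotropic_dims d p"
  unfolding anisotropic_dims_def
  by (auto simp: is_form_def only_trivial_zero_def intro!: exI[of _ 0])

lemma v_form_le_iff: "v_form d p \<le> enat N \<longleftrightarrow> (\<forall>n\<in>anisotropic_dims d p. n \<le> N)"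
  by (simp add: v_form_def SUP_le_iff)

lemma v_form_eq_enat_iff:
  "v_form d p = enat N \<longleftrightarrow>
     N \<in> anisotropic_dims d p \<and> (\<forall>n\<in>anisotropic_dims d p. n \<le> N)"
proof
  assume v: "v_form d p = enat N"
  hence le: "\<forall>n\<in>anisotropic_dims d p. n \<le> N"
    using v_form_le_iff[of d p N] by simp
  hence fin: "finite (anisotropic_dims d p)"
    by (meson finite_nat_set_iff_bounded_le)
  define M where "M = Max (anisotropic_dims d p)"
  have M: "M \<in> anisotropic_dims d p" "\<forall>n\<in>anisotropic_dims d p. n \<le> M"
    using fin zero_in_anisotropic_dims[of d p] unfolding M_def by (auto intro!: Max_in)
  hence "v_form d p \<le> enat M"
    by (simp add: v_form_le_iff)
  hence "N = M"
    using v M le by (intro antisym) simp_all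
  thus "N \<in> anisotropic_dims d p \<and> (\<forall>n\<in>anisotropic_dims d p. n \<le> N)"
    using M by simp
next
  assume "N \<in> anisotropic_dims d p \<and> (\<forall>n\<in>anisotropic_dims d p. n \<le> N)"
  moreover from this have "enat N \<le> v_form d p"
    unfolding v_form_def by (intro SUP_upper) simp
  ultimately show "v_form d p = enat N"
    by (intro antisym) (simp_all add: v_form_le_iff)
qed

lemma v_form_le_iff_nontrivial_zero:
  fixes p :: "'p :: prime_card itself"
  shows "v_form d p \<le> enat N \<longleftrightarrow>
     (\<forall>n>N. \<forall>F :: 'p padic mpoly. is_form d n F \<longrightarrow>
        (\<exists>x. mpoly_eval F x = 0 \<and> (\<exists>i<n. x i \<noteq> 0)))"
  unfolding v_form_le_iff anisotropic_dims_def only_trivial_zero_def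
  by (simp only: mem_Collect_eq Ball_def) (meson linorder_not_le)

end

theory Submission
  imports Defs "HOL-Library.Function_Algebras"
begin

text \<open>
  Brauer's method. Call a set of vectors diagonal for a form if the form is diagonal in these
  vectors. A vector extends a diagonal set of \<open>k\<close> vectors for a quartic form iff it is a zero of
  \<open>k\<close> cubic, \<open>k (k + 1) / 2\<close> quadratic and \<open>(k + 2 choose 3)\<close> linear forms. Such systems are solved
  by the same method: a quadratic (cubic) form that is diagonal in 5 (4) vectors has a zero over the
  dyadic numbers, so it suffices to find that many vectors on whose span the other forms vanish.
  In this way all diagonal sets of at most 5 vectors can be extended when there are at least 8031
  variables.

  Six vectors are fewer than a diagonal quartic form needs to be isotropic, but the extension is
  adaptive: vectors of the diagonal set can be replaced by linear combinations before the next vector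
  is chosen. Only the valuations of the values modulo 4 matter. Adding two values of
  equal valuation raises the valuation, and a value whose valuation has been raised by 4 can be
  corrected to 0, since numbers congruent to 1 modulo 16 are fourth powers. So the form is isotropic
  as soon as four vectors realize all four classes of valuations modulo 4, and a case distinction
  on the classes that occur reduces everything to this situation.
\<close>

section \<open>Dyadic numbers\<close>

text \<open>The price of diagonal vectors shapes the proof. Fourth powers of dyadic integers are 0
  or 1 modulo 16, so x_1^4 + ... + x_15^4 has only the trivial zero, and a diagonal form without
  further choices needs at least 16 vectors. To extend k vectors, the cubic conditions are traded
  for quadratic ones until there are 2k(k + 1) of them, and Q quadratic forms take 2Q^2 + 2Q + 1
  dimensions; so the number of variables grows like 8k^4. For k = 15 it exceeds 460000, for k = 5 it
  is 8031. Hence the argument has to live on six places: a merge consumes two vectors and returns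
  one, and the place that it frees can be filled again. The vectors are separated from the values.
  \<open>diagonal_values\<close> keeps only the rules by which the multiset of values may change,
  and the rest is combinatorics of valuations, uniform in the degree. The numbers 5 and 4 of vectors
  for quadratic and cubic forms are sharp: x^2 + y^2 + z^2 + w^2 and x^3 + 2y^3 + 4z^3 have no
  non-trivial dyadic zero.\<close>

lemma Rep_padic_int_reduce:
  "Rep_padic_int z n = Rep_padic_int z (n + k) mod int CARD('p) ^ n" for z :: "'p :: prime_card padic_int"
  by (rule padic_int_reduce) (rule CollectD[OF Rep_padic_int])

lemma Rep_padic_int_of_nat:
  "Rep_padic_int (of_nat m :: 'p :: prime_card padic_int) n = int m mod int CARD('p) ^ n"
proof (induction m)
  case 0
  show ?case by (simp add: zero_padic_int.rep_eq)
next
  case (Suc m)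
  show ?case
    by (simp only: of_nat_Suc plus_padic_int.rep_eq one_padic_int.rep_eq Suc.IH mod_add_eq)
qed

text \<open>For the converse the quotient is written down as a compatible sequence: its entry
  \<open>n\<close> is entry \<open>n + k\<close> of \<open>z\<close> divided by p^k, where the shift
  makes up for the digits lost in the division.\<close>

lemma power_dvd_padic_int_iff:
  fixes z :: "'p :: prime_card padic_int"
  shows "of_nat CARD('p) ^ k dvd z \<longleftrightarrow> Rep_padic_int z k = 0"
proof
  assume "of_nat CARD('p) ^ k dvd z"
  then obtain w where w: "z = of_nat (CARD('p) ^ k) * w"
    unfolding of_nat_power by (rule dvdE)
  show "Rep_padic_int z k = 0"
    by (simp only: w times_padic_int.rep_eq Rep_padic_int_of_nat of_nat_power[where 'a = int] mod_self mult_zero_left mod_0)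
next
  let ?p = "int CARD('p)"
  let ?f = "Rep_padic_int z"
  assume z: "?f k = 0"
  have red: "?f n = ?f (n + j) mod ?p ^ n" for n j
    by (rule Rep_padic_int_reduce)
  define g where "g n = ?f (n + k) div ?p ^ k" for n
  have g: "?f (n + k) = ?p ^ k * g n" for n
  proof -
    have "?p ^ k dvd ?f (n + k)"
      using trans[OF red[of k n, symmetric] z] by (simp only: add.commute[of k n] mod_0_imp_dvd)
    thus ?thesis
      unfolding g_def by (simp only: dvd_mult_div_cancel)
  qed
  have "g n = g (Suc n) mod ?p ^ n" for n
  proof -
    have "?p ^ k * g n = (?p ^ k * g (Suc n)) mod ?p ^ (n + k)"
      using red[of "n + k" 1] unfolding g[symmetric] by (simp only: add_Suc Suc_eq_plus1 add_ac)
    also have "\<dots> = ?p ^ k * (g (Suc n) mod ?p ^ n)"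
      by (simp only: power_add mult.commute[of "?p ^ n"] mult_mod_right)
    finally show ?thesis
      by (rule mult_left_cancel[THEN iffD1, rotated]) simp
  qed
  hence w: "Rep_padic_int (Abs_padic_int g :: 'p padic_int) = g"
    by (intro Abs_padic_int_inverse CollectI allI)
  have "z = of_nat (CARD('p) ^ k) * Abs_padic_int g"
  proof (rule Rep_padic_int_inject[THEN iffD1], rule ext)
    fix n
    have "Rep_padic_int (of_nat (CARD('p) ^ k) * Abs_padic_int g :: 'p padic_int) n
        = ?p ^ k * g n mod ?p ^ n"
      by (simp only: times_padic_int.rep_eq w Rep_padic_int_of_nat mod_mult_left_eq of_nat_power[where 'a = int])
    also have "\<dots> = ?f n"
      unfolding g[symmetric] by (rule red[symmetric])
    finally show "?f n = Rep_padic_int (of_nat (CARD('p) ^ k) * Abs_padic_int g :: 'p padic_int) n"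
      by (rule sym)
  qed
  thus "of_nat CARD('p) ^ k dvd z"
    by (simp only: of_nat_power dvd_triv_left)
qed

lemma Rep_padic_int_eq_iff_dvd:
  fixes x y :: "'p :: prime_card padic_int"
  shows "of_nat CARD('p) ^ k dvd x - y \<longleftrightarrow> Rep_padic_int x k = Rep_padic_int y k"
proof
  have mod_self: "Rep_padic_int z k mod int CARD('p) ^ k = Rep_padic_int z k" for z :: "'p padic_int"
    using Rep_padic_int_reduce[of z k 0] by simp
  show "Rep_padic_int x k = Rep_padic_int y k" if "of_nat CARD('p) ^ k dvd x - y"
  proof -
    have "Rep_padic_int (x - y + y) k = Rep_padic_int y k"
      using that by (simp only: plus_padic_int.rep_eq power_dvd_padic_int_iff add_0 mod_self)
    thus ?thesis
      by simp
  qed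
  show "of_nat CARD('p) ^ k dvd x - y" if "Rep_padic_int x k = Rep_padic_int y k"
    using that by (simp only: power_dvd_padic_int_iff minus_padic_int.rep_eq diff_self mod_0)
qed

text \<open>This contraction principle plays the role of Hensel's lemma.\<close>

lemma padic_int_fixed_point:
  fixes g :: "'p :: prime_card padic_int \<Rightarrow> 'p padic_int"
  assumes g: "\<And>x y. x - y dvd g x - g y"
  shows "\<exists>y. y = c + of_nat CARD('p) * g y"
proof -
  let ?P = "of_nat CARD('p) :: 'p padic_int"
  define h where "h y = c + ?P * g y" for y
  have h: "?P ^ Suc k dvd h x - h y" if "?P ^ k dvd x - y" for k x y
  proof -
    have "?P * ?P ^ k dvd ?P * (g x - g y)"
      by (rule mult_dvd_mono[OF dvd_refl dvd_trans[OF that g]])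
    also have "?P * (g x - g y) = h x - h y"
      by (simp add: h_def algebra_simps)
    finally show ?thesis
      by (simp only: power_Suc)
  qed
  define y where "y k = (h ^^ k) 0" for k
  have y: "Rep_padic_int (y (Suc k)) k = Rep_padic_int (y k) k" for k
  proof (rule Rep_padic_int_eq_iff_dvd[THEN iffD1], induction k)
    case 0
    show ?case by simp
  next
    case (Suc k)
    show ?case using h[OF Suc] by (simp add: y_def)
  qed
  \<comment> \<open>From the iterate \<open>y k\<close> on, the residues modulo p^k no longer
    change, so the diagonal sequence is compatible and represents the limit of the
    iteration.\<close>
  define f where "f n = Rep_padic_int (y n) n" for n
  have "f n = f (Suc n) mod int CARD('p) ^ n" for n
    unfolding f_def by (subst y[symmetric]) (use Rep_padic_int_reduce[of "y (Suc n)" n 1] in simp)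
  hence Rep: "Rep_padic_int (Abs_padic_int f :: 'p padic_int) = f"
    by (intro Abs_padic_int_inverse CollectI allI)
  define z :: "'p padic_int" where "z = Abs_padic_int f"
  have "?P ^ k dvd z - y k" for k
    by (simp only: Rep_padic_int_eq_iff_dvd z_def Rep f_def)
  hence "?P ^ Suc k dvd h z - y (Suc k)" for k
    using h[of k z "y k"] by (simp add: y_def)
  hence hz: "Rep_padic_int (h z) (Suc k) = Rep_padic_int z (Suc k)" for k
    using Rep_padic_int_eq_iff_dvd[of "Suc k" "h z" "y (Suc k)"] by (simp add: z_def Rep f_def)
  have "Rep_padic_int (h z) k = Rep_padic_int z k" for k
    using hz[of k] Rep_padic_int_reduce[of _ k 1] by (metis Suc_eq_plus1)
  hence "h z = z"
    by (intro Rep_padic_int_inject[THEN iffD1] ext)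
  thus ?thesis
    unfolding h_def by (intro exI[of _ z]) simp
qed

type_synonym dyadic_int = "2 padic_int"
type_synonym dyadic = "2 padic"

lemma power_dvd_dyadic_int_iff: "2 ^ k dvd z \<longleftrightarrow> Rep_padic_int z k = 0" for z :: dyadic_int
  using power_dvd_padic_int_iff[of k z] by simp

lemma dyadic_int_fixed_point:
  fixes g :: "dyadic_int \<Rightarrow> dyadic_int"
  assumes "\<And>x y. x - y dvd g x - g y"
  shows "\<exists>y. y = c + 2 * g y"
  using padic_int_fixed_point[of g c] assms by simp

lemma not_two_dvd_one: "\<not> 2 dvd (1 :: dyadic_int)"
  using power_dvd_dyadic_int_iff[of 1 1] by (simp add: one_padic_int.rep_eq)

lemma two_dvd_dyadic_int_cases:
  fixes z :: dyadic_int
  obtains "2 dvd z" | "2 dvd z - 1"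
proof -
  have "Rep_padic_int z 1 = Rep_padic_int z 1 mod 2"
    using Rep_padic_int_reduce[of z 1 0] by simp
  hence "Rep_padic_int z 1 = 0 \<or> Rep_padic_int z 1 = Rep_padic_int (1 :: dyadic_int) 1"
    by (simp add: one_padic_int.rep_eq) presburger
  thus ?thesis
    using that power_dvd_dyadic_int_iff[of 1 z] Rep_padic_int_eq_iff_dvd[of 1 z 1] by auto
qed

lemma not_two_dvd_unit: "2 dvd u - 1 \<Longrightarrow> \<not> 2 dvd u" for u :: dyadic_int
  using dvd_diff[of 2 u "u - 1"] not_two_dvd_one by auto

text \<open>With u = 1 + 2w the inverse is a solution of v = 1 - 2wv, which is an equation for the
  contraction principle.\<close>

lemma dyadic_int_unit:
  fixes u :: dyadic_int
  assumes "2 dvd u - 1"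
  obtains v where "u * v = 1"
proof -
  obtain w where w: "u - 1 = 2 * w"
    using assms by (rule dvdE)
  have "x - y dvd (- w * x) - (- w * y)" for x y
    by (rule dvdI[of _ _ "- w"]) (simp add: algebra_simps)
  then obtain v where "v = 1 + 2 * (- w * v)"
    using dyadic_int_fixed_point[of "\<lambda>y. - w * y" 1] by blast
  moreover have "u * v = v - 2 * (- w * v)"
    unfolding diff_eq_eq[THEN iffD1, OF w] by (simp add: algebra_simps)
  ultimately have "u * v = 1"
    by (simp only: diff_eq_eq)
  thus ?thesis ..
qed

lemma dyadic_int_decompose:
  fixes z :: dyadic_int
  assumes "z \<noteq> 0"
  obtains k u where "z = 2 ^ k * u" "2 dvd u - 1"
proof -
  obtain n where "\<not> 2 ^ n dvd z"
    using assms Rep_padic_int_inject[of z 0]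
    by (auto simp: power_dvd_dyadic_int_iff zero_padic_int.rep_eq fun_eq_iff)
  hence "\<exists>k u. z = 2 ^ k * u \<and> \<not> 2 dvd u"
  proof (induction n)
    case (Suc n)
    show ?case
    proof (cases "2 ^ n dvd z")
      case True
      then obtain u where u: "z = 2 ^ n * u"
        by (rule dvdE)
      have "\<not> 2 dvd u"
        using Suc.prems unfolding u by (auto simp: mult.commute[of 2])
      thus ?thesis
        using u by blast
    qed (rule Suc.IH)
  qed simp
  thus ?thesis
    using that two_dvd_dyadic_int_cases by metis
qed

text \<open>Two square roots are taken in turn, 1 + 16z = (1 + 8y)^2 and 1 + 8y = (1 + 4x)^2. After
  division by 16 and by 8 both equations have fixed-point form.\<close>

lemma dyadic_int_fourth_power: "\<exists>t. 1 + 16 * z = t ^ 4" for z :: dyadic_int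
proof -
  have "x - y dvd - (2 * x * x) - - (2 * y * y)" for x y :: dyadic_int
    by (rule dvdI[of _ _ "- 2 * (x + y)"]) (simp add: algebra_simps)
  hence "\<exists>y. y = z + 2 * (- (2 * y * y))"
    by (rule dyadic_int_fixed_point)
  then obtain y where y: "y = z - 4 * (y * y)"
    by auto
  have "x - y dvd - (x * x) - - (y * y)" for x y :: dyadic_int
    by (rule dvdI[of _ _ "- (x + y)"]) (simp add: algebra_simps)
  hence "\<exists>x. x = y + 2 * (- (x * x))"
    by (rule dyadic_int_fixed_point)
  then obtain x where x: "x = y - 2 * (x * x)"
    by auto
  have z: "z = y + 4 * (y * y)" and y': "y = x + 2 * (x * x)"
    using x y by (simp_all only: eq_diff_eq)
  have "1 + 16 * z = (1 + 8 * y) ^ 2"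
    by (subst z) (simp add: algebra_simps power2_eq_square)
  also have "1 + 8 * y = (1 + 4 * x) ^ 2"
    by (subst y') (simp add: algebra_simps power2_eq_square)
  also have "((1 + 4 * x) ^ 2) ^ 2 = (1 + 4 * x) ^ 4"
    by simp
  finally have "1 + 16 * z = (1 + 4 * x) ^ 4" .
  thus ?thesis ..
qed

lemma dyadic_int_square: "\<exists>t. 1 + 8 * z = t ^ 2" for z :: dyadic_int
proof -
  have "x - y dvd - (x * x) - - (y * y)" for x y :: dyadic_int
    by (rule dvdI[of _ _ "- (x + y)"]) (simp add: algebra_simps)
  hence "\<exists>y. y = z + 2 * (- (y * y))"
    by (rule dyadic_int_fixed_point)
  then obtain y where "y = z - 2 * (y * y)"
    by auto
  hence z: "z = y + 2 * (y * y)"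
    by (simp only: eq_diff_eq)
  have "1 + 8 * z = (1 + 4 * y) ^ 2"
    by (subst z) (simp add: algebra_simps power2_eq_square)
  thus ?thesis ..
qed

text \<open>Expanding (1 + 2y)^3 gives z = 3y + 6y^2 + 4y^3. As 3 is odd, one y can be split off and
  the remainder is divisible by 2, so every unit is a cube.\<close>

lemma dyadic_int_cube: "\<exists>t. 1 + 2 * z = t ^ 3" for z :: dyadic_int
proof -
  have "x - y dvd - (x + 3 * x ^ 2 + 2 * x ^ 3) - - (y + 3 * y ^ 2 + 2 * y ^ 3)" for x y :: dyadic_int
    by (rule dvdI[of _ _ "- (1 + 3 * (x + y) + 2 * (x ^ 2 + x * y + y ^ 2))"])
      (simp add: algebra_simps power2_eq_square power3_eq_cube)
  hence "\<exists>y. y = z + 2 * (- (y + 3 * y ^ 2 + 2 * y ^ 3))"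
    by (rule dyadic_int_fixed_point)
  then obtain y where "y = z - 2 * (y + 3 * y ^ 2 + 2 * y ^ 3)"
    by auto
  hence z: "z = y + 2 * (y + 3 * y ^ 2 + 2 * y ^ 3)"
    by (simp only: eq_diff_eq)
  have "1 + 2 * z = (1 + 2 * y) ^ 3"
    by (subst z) (simp add: algebra_simps power2_eq_square power3_eq_cube)
  thus ?thesis ..
qed

subsection \<open>Valuations\<close>

definition dyadic_of_int :: "dyadic_int \<Rightarrow> dyadic" where
  "dyadic_of_int z = Fract z 1"

lemma dyadic_of_int_simps [simp]:
  "dyadic_of_int 0 = 0" "dyadic_of_int 1 = 1"
  "dyadic_of_int (x + y) = dyadic_of_int x + dyadic_of_int y"
  "dyadic_of_int (x - y) = dyadic_of_int x - dyadic_of_int y"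
  "dyadic_of_int (x * y) = dyadic_of_int x * dyadic_of_int y"
  "dyadic_of_int (- x) = - dyadic_of_int x"
  by (simp_all add: dyadic_of_int_def Zero_fract_def One_fract_def)

lemma dyadic_of_int_power [simp]: "dyadic_of_int (x ^ n) = dyadic_of_int x ^ n"
  by (induction n) simp_all

lemma dyadic_of_int_of_nat: "dyadic_of_int (of_nat n) = of_nat n"
  by (induction n) simp_all

lemma dyadic_of_int_numeral [simp]: "dyadic_of_int (numeral n) = numeral n"
  using dyadic_of_int_of_nat[of "numeral n"] by simp

lemma dyadic_of_int_inject [simp]: "dyadic_of_int x = dyadic_of_int y \<longleftrightarrow> x = y"
  by (simp add: dyadic_of_int_def eq_fract)

text \<open>Characteristic 0, needed to divide by 4! in the polarization. Since n < 2^n, the residue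
  of \<open>n\<close> modulo 2^n is \<open>n\<close> itself.\<close>

lemma of_nat_dyadic_eq_0_iff: "(of_nat n :: dyadic) = 0 \<longleftrightarrow> n = 0"
proof
  assume "(of_nat n :: dyadic) = 0"
  hence "dyadic_of_int (of_nat n) = dyadic_of_int (of_nat 0)"
    by (simp add: dyadic_of_int_of_nat)
  hence "of_nat n = (of_nat 0 :: dyadic_int)"
    by (simp only: dyadic_of_int_inject)
  hence "Rep_padic_int (of_nat n :: dyadic_int) n = Rep_padic_int (of_nat 0 :: dyadic_int) n"
    by (rule arg_cong)
  hence "int n mod 2 ^ n = 0"
    unfolding Rep_padic_int_of_nat by simp
  moreover have "int n < 2 ^ n"
    using of_nat_less_two_power[of n, where 'a = int] by simp
  ultimately show "n = 0"
    by simp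
qed simp

lemma two_dyadic_nonzero [simp]: "(2 :: dyadic) \<noteq> 0"
  using of_nat_dyadic_eq_0_iff[of 2] by simp

text \<open>Valuations are relations rather than a function, so 0 needs no conventional value:
  \<open>val_ge n 0\<close> holds for every \<open>n\<close>, and \<open>val_eq n\<close> excludes
  0.\<close>

definition val_ge :: "int \<Rightarrow> dyadic \<Rightarrow> bool" where
  "val_ge n x \<longleftrightarrow> (\<exists>z. x = 2 powi n * dyadic_of_int z)"

definition val_eq :: "int \<Rightarrow> dyadic \<Rightarrow> bool" where
  "val_eq n x \<longleftrightarrow> (\<exists>u. x = 2 powi n * dyadic_of_int u \<and> 2 dvd u - 1)"

lemma val_geI: "x = 2 powi n * dyadic_of_int z \<Longrightarrow> val_ge n x"
  by (auto simp: val_ge_def)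

lemma val_eqI: "x = 2 powi n * dyadic_of_int u \<Longrightarrow> 2 dvd u - 1 \<Longrightarrow> val_eq n x"
  by (auto simp: val_eq_def)

lemma val_ge_0 [simp]: "val_ge n 0"
  by (rule val_geI[of _ _ 0]) simp

lemma val_geE:
  assumes "val_ge n x"
  obtains z where "x = 2 powi n * dyadic_of_int z"
  using assms unfolding val_ge_def by blast

lemma val_eqE:
  assumes "val_eq n x"
  obtains u where "x = 2 powi n * dyadic_of_int u" "2 dvd u - 1"
  using assms unfolding val_eq_def by blast

lemma val_ge_add:
  assumes "val_ge n x" "val_ge n y"
  shows "val_ge n (x + y)"
proof -
  obtain z w where "x = 2 powi n * dyadic_of_int z" "y = 2 powi n * dyadic_of_int w"
    using assms by (elim val_geE)
  thus ?thesis
    by (intro val_geI[of _ _ "z + w"]) (simp add: distrib_left)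
qed

lemma val_ge_uminus:
  assumes "val_ge n x"
  shows "val_ge n (- x)"
proof -
  obtain z where "x = 2 powi n * dyadic_of_int z"
    using assms by (rule val_geE)
  thus ?thesis
    by (intro val_geI[of _ _ "- z"]) simp
qed

lemma val_ge_diff: "val_ge n x \<Longrightarrow> val_ge n y \<Longrightarrow> val_ge n (x - y)"
  using val_ge_add[of n x "- y"] val_ge_uminus[of n y] by simp

lemma val_ge_mono:
  assumes "val_ge n x" "m \<le> n"
  shows "val_ge m x"
proof -
  have "n = m + int (nat (n - m))"
    using assms(2) by simp
  then obtain z where "x = 2 powi (m + int (nat (n - m))) * dyadic_of_int z"
    using val_geE[OF assms(1)] by metis
  hence "x = 2 powi m * dyadic_of_int (2 ^ nat (n - m) * z)"
    by (simp only: power_int_add two_dyadic_nonzero power_int_of_nat simp_thms dyadic_of_int_simps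
        dyadic_of_int_power dyadic_of_int_numeral mult.assoc)
  thus ?thesis
    by (rule val_geI)
qed

lemma val_eq_imp_val_ge: "val_eq n x \<Longrightarrow> val_ge n x"
  by (erule val_eqE) (rule val_geI)

lemma val_eq_imp_not_val_ge:
  assumes "val_eq n x" "n < m"
  shows "\<not> val_ge m x"
proof
  assume "val_ge m x"
  hence "val_ge (n + 1) x"
    by (rule val_ge_mono) (use assms in simp)
  then obtain z where z: "x = 2 powi (n + 1) * dyadic_of_int z"
    by (rule val_geE)
  obtain u where u: "x = 2 powi n * dyadic_of_int u" "2 dvd u - 1"
    using assms(1) by (rule val_eqE)
  have "2 powi n * dyadic_of_int u = 2 powi n * dyadic_of_int (2 * z)"
    using z unfolding u(1) by (simp add: power_int_add)
  hence "dyadic_of_int u = dyadic_of_int (2 * z)"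
    by simp
  hence "u = 2 * z"
    by (simp only: dyadic_of_int_inject)
  thus False
    using not_two_dvd_unit[OF u(2)] by simp
qed

lemma val_ge_cases:
  assumes "val_ge n x"
  obtains "val_ge (n + 1) x" | "val_eq n x"
proof -
  obtain z where z: "x = 2 powi n * dyadic_of_int z"
    using assms by (rule val_geE)
  show ?thesis
  proof (rule two_dvd_dyadic_int_cases[of z])
    assume "2 dvd z"
    then obtain w where w: "z = 2 * w"
      by (rule dvdE)
    show ?thesis
      by (rule that(1), rule val_geI[of _ _ w]) (simp add: z w power_int_add)
  next
    assume "2 dvd z - 1"
    thus ?thesis
      by (rule that(2)[OF val_eqI[OF z]])
  qed
qed

lemma ex_val_eq:
  assumes "x \<noteq> 0"
  obtains n where "val_eq n x"
proof -
  obtain a b where x: "x = Fract a b" "a \<noteq> 0" "b \<noteq> 0"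
    using assms by (cases x rule: Fract_cases_nonzero) auto
  obtain i u where u: "a = 2 ^ i * u" "2 dvd u - 1"
    using x(2) by (rule dyadic_int_decompose)
  obtain j v where v: "b = 2 ^ j * v" "2 dvd v - 1"
    using x(3) by (rule dyadic_int_decompose)
  obtain w where w: "v * w = 1"
    using v(2) by (rule dyadic_int_unit)
  have "2 dvd w - 1"
  proof (rule two_dvd_dyadic_int_cases[of w])
    assume "2 dvd w"
    hence "2 dvd v * w"
      by (rule dvd_mult)
    thus ?thesis
      using w not_two_dvd_one by simp
  qed
  hence "2 dvd u * (w - 1) + (u - 1)"
    using u(2) by (intro dvd_add dvd_mult)
  hence uw: "2 dvd u * w - 1"
    by (simp add: algebra_simps)
  have b: "dyadic_of_int b \<noteq> 0"
    using x(3) dyadic_of_int_inject[of b 0] by simp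
  have "x * dyadic_of_int b = dyadic_of_int a"
    using x(3) unfolding x(1) dyadic_of_int_def by (simp add: eq_fract)
  also have "dyadic_of_int a = (2 powi (int i - int j) * 2 ^ j) * dyadic_of_int (u * (v * w))"
    unfolding w u(1) by (simp add: power_int_diff)
  also have "\<dots> = 2 powi (int i - int j) * dyadic_of_int (u * w) * dyadic_of_int b"
    by (simp add: v(1) ac_simps)
  finally have "x = 2 powi (int i - int j) * dyadic_of_int (u * w)"
    by (rule mult_right_cancel[OF b, THEN iffD1])
  thus ?thesis
    by (rule that[OF val_eqI[OF _ uw]])
qed

lemma val_eq_exists_above:
  assumes "x \<noteq> 0" "val_ge m x"
  obtains n where "val_eq n x" "m \<le> n"
proof -
  obtain n where n: "val_eq n x"
    using assms(1) by (rule ex_val_eq)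
  show ?thesis
    using that[OF n] val_eq_imp_not_val_ge[OF n, of m] assms(2) by linarith
qed

text \<open>The residue field has two elements, so the sum of two units is never a unit. This is
  what drives all merging arguments.\<close>

lemma val_eq_add_val_eq:
  assumes "val_eq n x" "val_eq n y"
  shows "val_ge (n + 1) (x + y)"
proof -
  obtain u v where u: "x = 2 powi n * dyadic_of_int u" "2 dvd u - 1"
    and v: "y = 2 powi n * dyadic_of_int v" "2 dvd v - 1"
    using assms by (elim val_eqE)
  have "2 dvd (u - 1) + (v - 1) + 2"
    using u(2) v(2) by (intro dvd_add) simp_all
  hence "2 dvd u + v"
    by (simp add: algebra_simps)
  then obtain w where "u + v = 2 * w"
    by (rule dvdE)
  hence "dyadic_of_int (u + v) = dyadic_of_int (2 * w)"
    by (rule arg_cong)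
  hence w: "dyadic_of_int u + dyadic_of_int v = 2 * dyadic_of_int w"
    by (simp only: dyadic_of_int_simps dyadic_of_int_numeral)
  show ?thesis
    unfolding u(1) v(1) distrib_left[symmetric] w
    by (intro val_geI[of _ _ w]) (simp add: power_int_add)
qed

lemma val_eq_add_val_ge:
  assumes "val_eq n x" "val_ge (n + 1) y"
  shows "val_eq n (x + y)"
proof -
  have "val_ge n (x + y)"
    using assms by (intro val_ge_add val_eq_imp_val_ge val_ge_mono[OF assms(2)]) simp_all
  thus ?thesis
  proof (rule val_ge_cases)
    assume "val_ge (n + 1) (x + y)"
    hence "val_ge (n + 1) (x + y - y)"
      using assms(2) by (rule val_ge_diff)
    thus ?thesis
      using val_eq_imp_not_val_ge[OF assms(1), of "n + 1"] by simp
  qed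
qed

lemma val_eq_mult_power:
  assumes "val_eq n x"
  shows "val_eq (n + k) (2 powi k * x)"
proof -
  obtain u where u: "x = 2 powi n * dyadic_of_int u" "2 dvd u - 1"
    using assms by (rule val_eqE)
  show ?thesis
    by (rule val_eqI[OF _ u(2)]) (simp add: u(1) power_int_add)
qed

lemma val_eq_double: "val_eq n x \<Longrightarrow> val_eq (n + 1) (x + x)"
  using val_eq_mult_power[of n x 1] by (simp only: power_int_1_right mult_2)

text \<open>The unit part of \<open>a\<close> is invertible, so \<open>b\<close> is \<open>a\<close>
  times a number congruent to 1 modulo 2^e, which \<open>root\<close> makes a d-th power.\<close>

lemma dyadic_power_multiple:
  fixes a b :: dyadic and d e :: nat
  assumes "val_eq n a" "val_ge (n + int e) (b - a)" "e > 0"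
    and root: "\<And>z :: dyadic_int. \<exists>t. 1 + 2 ^ e * z = t ^ d"
  obtains t where "t \<noteq> 0" "b = t ^ d * a"
proof -
  obtain u where u: "a = 2 powi n * dyadic_of_int u" "2 dvd u - 1"
    using assms(1) by (rule val_eqE)
  obtain z where z: "b - a = 2 powi (n + int e) * dyadic_of_int z"
    using assms(2) by (rule val_geE)
  obtain v where v: "u * v = 1"
    using u(2) by (rule dyadic_int_unit)
  obtain t where t: "1 + 2 ^ e * (z * v) = t ^ d"
    using root by blast
  have "b = a + 2 powi n * 2 ^ e * dyadic_of_int (z * (u * v))"
    using z by (simp add: v power_int_add diff_eq_eq add.commute)
  also have "\<dots> = dyadic_of_int (1 + 2 ^ e * (z * v)) * a"
    unfolding u(1) by (simp add: algebra_simps)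
  finally have b: "b = dyadic_of_int t ^ d * a"
    by (simp only: t dyadic_of_int_power)
  \<comment> \<open>The root supplied by \<open>root\<close> could be 0 only for
    \<open>d = 0\<close>; then its power is 1 and it may be replaced by 1.\<close>
  show ?thesis
  proof (cases "t = 0")
    case True
    have "d = 0"
    proof (rule ccontr)
      assume "d \<noteq> 0"
      hence "1 = - (2 ^ e * (z * v))"
        using t True by (simp add: eq_neg_iff_add_eq_0)
      moreover have "2 dvd (2 :: dyadic_int) ^ e"
        using assms(3) by (intro dvd_power) auto
      ultimately show False
        using not_two_dvd_one by (metis dvd_minus_iff dvd_mult2)
    qed
    thus ?thesis
      using that[of 1] b by simp
  next
    case False
    thus ?thesis
      using that[of "dyadic_of_int t"] b dyadic_of_int_inject[of t 0] by simp
  qed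
qed

section \<open>Values of diagonal forms\<close>

text \<open>\<open>R N\<close> is to be read as: \<open>N\<close> consists of the values of a form
  of degree \<open>d\<close> at vectors in which it is diagonal. Then \<open>nonzero\<close> is
  anisotropy, \<open>scale\<close> multiplies a vector by \<open>t\<close>, and \<open>merge\<close>
  replaces two vectors by their sum.\<close>

locale diagonal_values =
  fixes d e :: nat and R :: "dyadic multiset \<Rightarrow> bool"
  assumes nonzero: "R N \<Longrightarrow> 0 \<notin># N"
    and drop: "R (add_mset a N) \<Longrightarrow> R N"
    and scale: "R (add_mset a N) \<Longrightarrow> t \<noteq> 0 \<Longrightarrow> R (add_mset (t ^ d * a) N)"
    and merge: "R (add_mset a (add_mset b N)) \<Longrightarrow> R (add_mset (a + b) N)"
    and root: "\<And>z :: dyadic_int. \<exists>t. 1 + 2 ^ e * z = t ^ d"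
    and e_pos: "e > 0"
begin

text \<open>
  A free value can be moved arbitrarily modulo \<open>2\<^sup>n\<close>. Merging keeps it free, which is why a chain
  of merges that raises the valuation of a value by \<open>e\<close> ends in a zero.
\<close>

definition free :: "int \<Rightarrow> dyadic \<Rightarrow> dyadic multiset \<Rightarrow> bool" where
  "free n a N \<longleftrightarrow> (\<forall>a'. val_ge n (a' - a) \<longrightarrow> R (add_mset a' N))"

definition realizes :: "int multiset \<Rightarrow> bool" where
  "realizes W \<longleftrightarrow> (\<exists>N. R N \<and> rel_mset val_eq W N)"

definition realizes_free :: "int \<Rightarrow> int \<Rightarrow> int multiset \<Rightarrow> bool" where
  "realizes_free n w W \<longleftrightarrow> (\<exists>a N. val_eq w a \<and> free n a N \<and> rel_mset val_eq W N)"

text \<open>A number that agrees with \<open>a\<close> up to the relative accuracy 2^e is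
  \<open>a\<close> times a d-th power, hence within reach of \<open>scale\<close>.\<close>

lemma free_start:
  assumes "R (add_mset a N)" "val_eq w a"
  shows "free (w + int e) a N"
  unfolding free_def
proof (intro allI impI)
  fix a' assume "val_ge (w + int e) (a' - a)"
  then obtain t where "t \<noteq> 0" "a' = t ^ d * a"
    using dyadic_power_multiple[OF assms(2) _ e_pos root] by blast
  thus "R (add_mset a' N)"
    using scale[OF assms(1)] by simp
qed

lemma free_imp: "free n a N \<Longrightarrow> R (add_mset a N)"
  by (simp add: free_def)

text \<open>To reach a number \<open>c\<close> close to \<open>a + b\<close>, move \<open>a\<close>
  to \<open>c - b\<close> before merging; \<open>b\<close> stays fixed.\<close>

lemma free_merge:
  assumes "free n a (add_mset b N)"
  shows "free n (a + b) N"
  unfolding free_def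
proof (intro allI impI)
  fix c assume "val_ge n (c - (a + b))"
  hence "val_ge n (c - b - a)"
    by (simp only: diff_diff_eq add.commute)
  hence "R (add_mset (c - b) (add_mset b N))"
    using assms by (simp add: free_def)
  from merge[OF this] show "R (add_mset c N)"
    by simp
qed

text \<open>Otherwise the free value could be moved to 0.\<close>

lemma free_not_val_ge:
  assumes "free n a N"
  shows "\<not> val_ge n a"
proof
  assume "val_ge n a"
  hence "R (add_mset 0 N)"
    using assms val_ge_uminus[of n a] by (simp add: free_def)
  thus False
    using nonzero[of "add_mset 0 N"] by simp
qed

lemma free_val_eq:
  assumes "free n a N" "val_ge m a"
  obtains w where "val_eq w a" "m \<le> w" "w < n"
proof -
  have "a \<noteq> 0"
    using free_not_val_ge[OF assms(1)] by auto
  then obtain w where w: "val_eq w a" "m \<le> w"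
    using assms(2) by (rule val_eq_exists_above)
  have "w < n"
    using free_not_val_ge[OF assms(1)] val_ge_mono[OF val_eq_imp_val_ge[OF w(1)], of n] by linarith
  thus ?thesis
    using w by (intro that)
qed

lemma realizesE:
  assumes "realizes (add_mset w W)"
  obtains a N where "val_eq w a" "R (add_mset a N)" "rel_mset val_eq W N"
  using assms msed_rel_invL unfolding realizes_def by metis

lemma realizesI:
  assumes "val_eq w a" "R (add_mset a N)" "rel_mset val_eq W N"
  shows "realizes (add_mset w W)"
  using assms rel_mset_Plus[of val_eq w a W N] unfolding realizes_def by blast

lemma realizes_drop: "realizes (add_mset w W) \<Longrightarrow> realizes W"
  using drop unfolding realizes_def by (metis msed_rel_invL)

lemma realizes_subset:
  assumes "realizes W" "W' \<subseteq># W"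
  shows "realizes W'"
proof -
  have "realizes W'" if "realizes (U + W')" for U
    using that by (induction U) (auto dest: realizes_drop)
  thus ?thesis
    using assms by (metis subset_mset.diff_add)
qed

lemma val_eq_scale: "val_eq w a \<Longrightarrow> val_eq (w + int d * k) ((2 powi k) ^ d * a)"
  using val_eq_mult_power[of w a "int d * k"] by (simp only: power_int_mult power_int_of_nat power_int_power mult.commute)

lemma realizes_shift:
  assumes "realizes (add_mset w W)"
  shows "realizes (add_mset (w + int d * k) W)"
  using assms
proof (rule realizesE)
  fix a N assume "val_eq w a" "R (add_mset a N)" "rel_mset val_eq W N"
  thus ?thesis
    by (intro realizesI[OF val_eq_scale scale]) simp_all
qed

lemma realizes_normalize:
  assumes "realizes (add_mset w W)"
  shows "realizes (add_mset (s + (w - s) mod int d) W)"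
proof -
  have "s + (w - s) mod int d = w + int d * (- ((w - s) div int d))"
    using mult_div_mod_eq[of "int d" "w - s"] by (simp add: algebra_simps)
  thus ?thesis
    using realizes_shift[OF assms] by metis
qed

lemma realizes_free_start: "realizes (add_mset w W) \<Longrightarrow> realizes_free (w + int e) w W"
  unfolding realizes_free_def by (erule realizesE) (blast intro: free_start)

lemma realizes_free_imp: "realizes_free n w W \<Longrightarrow> realizes (add_mset w W)"
  unfolding realizes_free_def by (blast intro: realizesI free_imp)

text \<open>The accuracy \<open>n\<close> survives the merge while the valuation grows, so climbing
  must end. Applied with \<open>w + 1 = n\<close> the lemma yields a contradiction.\<close>

lemma realizes_free_climb:
  assumes "realizes_free n w (add_mset w W)"
  obtains w' where "w < w'" "w' < n" "realizes_free n w' W"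
proof -
  obtain a b N where ab: "val_eq w a" "val_eq w b" "rel_mset val_eq W N" "free n a (add_mset b N)"
    using assms msed_rel_invL unfolding realizes_free_def by metis
  from ab(4) have free: "free n (a + b) N"
    by (rule free_merge)
  obtain w' where "val_eq w' (a + b)" "w + 1 \<le> w'" "w' < n"
    using free val_eq_add_val_eq[OF ab(1,2)] by (rule free_val_eq)
  thus ?thesis
    using ab(3) free by (intro that[of w']) (auto simp: realizes_free_def)
qed

lemma realizes_free_shift:
  assumes "realizes_free n w (add_mset v W)"
  shows "realizes_free n w (add_mset (v + int d * k) W)"
proof -
  obtain a b N where ab: "val_eq w a" "val_eq v b" "rel_mset val_eq W N" "free n a (add_mset b N)"
    using assms msed_rel_invL unfolding realizes_free_def by metis
  have "free n a (add_mset ((2 powi k) ^ d * b) N)"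
    unfolding free_def
  proof (intro allI impI)
    fix a' assume "val_ge n (a' - a)"
    hence "R (add_mset b (add_mset a' N))"
      using ab(4) by (simp add: free_def add_mset_commute)
    from scale[OF this, of "2 powi k"] show "R (add_mset a' (add_mset ((2 powi k) ^ d * b) N))"
      by (simp add: add_mset_commute)
  qed
  thus ?thesis
    using ab(1) rel_mset_Plus[of val_eq, OF val_eq_scale[OF ab(2)] ab(3)]
    unfolding realizes_free_def by blast
qed

lemma realizes_normalize_all:
  assumes "realizes W"
  shows "realizes (image_mset (\<lambda>w. w mod int d) W)"
proof -
  have "realizes (image_mset (\<lambda>w. w mod int d) W + U)" if "realizes (W + U)" for U
    using that
  proof (induction W arbitrary: U)
    case (add w W)
    have "realizes (W + add_mset (w mod int d) U)"
      using realizes_normalize[of w "W + U" 0] add.prems by simp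
    from add.IH[OF this] show ?case
      by simp
  qed simp
  from this[of "{#}"] show ?thesis
    using assms by simp
qed

end

lemma mset_eq_replicate_two:
  assumes "set_mset M \<subseteq> {a, b}" "a \<noteq> b"
  shows "M = replicate_mset (count M a) a + replicate_mset (count M b) b"
proof (rule multiset_eqI)
  fix x
  show "count M x = count (replicate_mset (count M a) a + replicate_mset (count M b) b) x"
    using assms by (cases "x \<in># M") (auto simp: not_in_iff)
qed

section \<open>Diagonal quadratic forms in five vectors\<close>

locale square_values = diagonal_values 2 3 R for R
begin

text \<open>Two values of valuation \<open>s\<close> merge to \<open>s + 1\<close> or
  \<open>s + 2\<close>. At \<open>s + 1\<close> the last value continues the chain to
  \<open>s + 2\<close>; there the third value, scaled by a square to valuation \<open>s + 2\<close>,
  completes a zero.\<close>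

lemma not_realizes_three_one: "\<not> realizes {#s, s, s, s + 1#}"
proof
  assume "realizes {#s, s, s, s + 1#}"
  hence "realizes_free (s + 3) s {#s, s, s + 1#}"
    using realizes_free_start[of s] by simp
  then obtain w where w: "s < w" "w < s + 3" "realizes_free (s + 3) w {#s, s + 1#}"
    by (rule realizes_free_climb)
  have no: "\<not> realizes_free (s + 3) (s + 2) (add_mset s W)" for W
  proof
    assume "realizes_free (s + 3) (s + 2) (add_mset s W)"
    hence "realizes_free (s + 3) (s + 2) (add_mset (s + 2) W)"
      using realizes_free_shift[of "s + 3" "s + 2" s W 1] by simp
    thus False
      by (rule realizes_free_climb) simp
  qed
  hence "w = s + 1"
    using w by (cases "w = s + 2") auto
  hence "realizes_free (s + 3) (s + 1) {#s + 1, s#}"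
    using w(3) by (simp add: add_mset_commute)
  then obtain w' where "s + 1 < w'" "w' < s + 3" "realizes_free (s + 3) w' {#s#}"
    by (rule realizes_free_climb)
  moreover from this have "w' = s + 2"
    by simp
  ultimately show False
    using no[of "{#}"] by simp
qed

lemma not_realizes_five: "\<not> realizes {#s, s, s, s, s#}"
proof
  assume s: "realizes {#s, s, s, s, s#}"
  hence "realizes_free (s + 3) s {#s, s, s, s#}"
    using realizes_free_start[of s] by simp
  then obtain w where w: "s < w" "w < s + 3" "realizes_free (s + 3) w {#s, s, s#}"
    by (rule realizes_free_climb)
  consider "w = s + 1" | "w = s + 2"
    using w by linarith
  thus False
  proof cases
    case 1
    hence "realizes {#s, s, s, s + 1#}"
      using realizes_free_imp[OF w(3)] by (simp add: add_mset_commute)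
    thus False
      by (simp add: not_realizes_three_one)
  next
    case 2
    hence "realizes_free (s + 3) (s + 2) {#s + 2, s, s#}"
      using realizes_free_shift[of "s + 3" "s + 2" s "{#s, s#}" 1] w(3) by simp
    thus False
      by (rule realizes_free_climb) simp
  qed
qed

text \<open>By parity, five valuations either all lie in one class or contain three of one class
  together with one of the other.\<close>

lemma realizes_size_less_5:
  assumes "realizes W"
  shows "size W < 5"
proof (rule ccontr)
  assume size: "\<not> size W < 5"
  define M where "M = image_mset (\<lambda>w. w mod 2) W"
  have M: "realizes M"
    using realizes_normalize_all[OF assms] by (simp add: M_def)
  have "set_mset M \<subseteq> {0, 1}"
    by (auto simp: M_def)
  from mset_eq_replicate_two[OF this]
  have M_eq: "M = replicate_mset (count M 0) 0 + replicate_mset (count M 1) 1"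
    by simp
  have "size M \<ge> 5"
    using size by (simp add: M_def)
  hence counts: "count M 0 + count M 1 \<ge> 5"
    by (subst (asm) M_eq) simp
  have sub: "realizes U" if "count U 0 \<le> count M 0" "count U 1 \<le> count M 1" "set_mset U \<subseteq> {0, 1}" for U
  proof (rule realizes_subset[OF M])
    have "count U x \<le> count M x" for x
      using that by (cases "x \<in># U") (auto simp: not_in_iff)
    thus "U \<subseteq># M"
      by (simp add: subseteq_mset_def)
  qed
  consider "count M 0 \<ge> 5" | "count M 1 \<ge> 5" | "count M 0 \<ge> 3" "count M 1 \<ge> 1"
    | "count M 1 \<ge> 3" "count M 0 \<ge> 1"
    using counts by linarith
  thus False
  proof cases
    case 1
    thus False
      using not_realizes_five[of 0] sub[of "{#0, 0, 0, 0, 0#}"] by simp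
  next
    case 2
    thus False
      using not_realizes_five[of 1] sub[of "{#1, 1, 1, 1, 1#}"] by simp
  next
    case 3
    thus False
      using not_realizes_three_one[of 0] sub[of "{#0, 0, 0, 1#}"] by simp
  next
    case 4
    hence "realizes (add_mset 0 {#1, 1, 1#})"
      using sub[of "{#0, 1, 1, 1#}"] by simp
    from realizes_shift[OF this, of 1] show False
      using not_realizes_three_one[of 1] by (simp add: add_mset_commute)
  qed
qed

end

section \<open>Diagonal cubic forms in four vectors\<close>

locale cube_values = diagonal_values 3 1 R for R
begin

text \<open>All units are cubes, so the accuracy is \<open>s + 1\<close> and a single merge already
  gives a zero. Each class modulo 3 can therefore occur only once.\<close>

lemma not_realizes_two: "\<not> realizes (add_mset s (add_mset s W))"
proof
  assume "realizes (add_mset s (add_mset s W))"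
  hence "realizes_free (s + 1) s (add_mset s W)"
    using realizes_free_start by fastforce
  thus False
    by (rule realizes_free_climb) simp
qed

lemma realizes_size_less_4:
  assumes "realizes W"
  shows "size W < 4"
proof -
  define M where "M = image_mset (\<lambda>w. w mod 3) W"
  have M: "realizes M"
    using realizes_normalize_all[OF assms] by (simp add: M_def)
  have "count M x \<le> 1" for x
  proof (rule ccontr)
    assume "\<not> count M x \<le> 1"
    hence "{#x, x#} \<subseteq># M"
      by (auto simp: subseteq_mset_def)
    thus False
      using realizes_subset[OF M] not_realizes_two by blast
  qed
  hence "M \<subseteq># mset_set {0, 1, 2}"
    by (auto simp: subseteq_mset_def count_mset_set' not_in_iff[symmetric] M_def)
  hence "size M \<le> size (mset_set {0, 1, 2 :: int})"
    by (rule size_mset_mono)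
  thus ?thesis
    by (simp add: M_def)
qed

end

section \<open>Adaptive argument for quartic forms with six places\<close>

locale quartic_values = diagonal_values 4 4 R for R +
  assumes empty: "R {#}"
    and extend: "R N \<Longrightarrow> size N < 6 \<Longrightarrow> \<exists>a. R (add_mset a N)"
begin

text \<open>
  The sum of two values of valuation \<open>w\<close> always has valuation at least \<open>w + 1\<close>; for an opposite
  pair it skips this valuation, so that no value of valuation \<open>w + 1\<close> is needed to continue.
\<close>

definition opposite :: "int \<Rightarrow> int multiset \<Rightarrow> bool" where
  "opposite w W \<longleftrightarrow> (\<exists>a b N. val_eq w a \<and> val_eq w b \<and> val_ge (w + 2) (a + b) \<and>
     R (add_mset a (add_mset b N)) \<and> rel_mset val_eq W N)"

lemma extend_val_eq:
  assumes "R N" "size N < 6"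
  obtains x a where "val_eq x a" "R (add_mset a N)" "s \<le> x" "x < s + 4"
proof -
  obtain a where a: "R (add_mset a N)"
    using extend assms by blast
  then obtain w where w: "val_eq w a"
    using nonzero[of "add_mset a N"] by (auto elim: ex_val_eq)
  define k where "k = - ((w - s) div 4)"
  have "w + 4 * k = s + (w - s) mod 4"
    using minus_mult_div_eq_mod[of "w - s" 4] by (simp add: k_def)
  thus ?thesis
    using that[OF val_eq_scale[OF w, of k] scale[OF a, of "2 powi k"]] by simp
qed

lemma realizes_extend:
  assumes "realizes W" "size W < 6"
  obtains x where "realizes (add_mset x W)" "s \<le> x" "x < s + 4"
proof -
  obtain N where N: "R N" "rel_mset val_eq W N"
    using assms(1) unfolding realizes_def by blast
  hence "size N < 6"
    using assms(2) by (metis rel_mset_size)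
  then obtain x a where "val_eq x a" "R (add_mset a N)" "s \<le> x" "x < s + 4"
    using N(1) extend_val_eq by metis
  thus ?thesis
    using N(2) by (intro that[of x] realizesI)
qed

text \<open>The opposite pair occupies two of the six places, whence the bound 4.\<close>

lemma opposite_extend:
  assumes "opposite w W" "size W < 4"
  obtains x where "opposite w (add_mset x W)" "s \<le> x" "x < s + 4"
proof -
  obtain a b N where ab: "val_eq w a" "val_eq w b" "val_ge (w + 2) (a + b)"
      "R (add_mset a (add_mset b N))" "rel_mset val_eq W N"
    using assms(1) unfolding opposite_def by blast
  have "size (add_mset a (add_mset b N)) < 6"
    using assms(2) rel_mset_size[OF ab(5)] by simp
  then obtain x c where c: "val_eq x c" "R (add_mset c (add_mset a (add_mset b N)))"
      "s \<le> x" "x < s + 4"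
    using ab(4) extend_val_eq by metis
  have "R (add_mset a (add_mset b (add_mset c N)))"
    using c(2) by (simp add: add_mset_commute)
  thus ?thesis
    using that[of x] ab c rel_mset_Plus[of val_eq x c W N] unfolding opposite_def by blast
qed

lemma opposite_shift:
  assumes "opposite w (add_mset v W)"
  shows "opposite w (add_mset (v + 4 * k) W)"
proof -
  obtain a b c N where ab: "val_eq w a" "val_eq w b" "val_ge (w + 2) (a + b)"
      "R (add_mset a (add_mset b (add_mset c N)))" "val_eq v c" "rel_mset val_eq W N"
    using assms msed_rel_invL unfolding opposite_def by metis
  have "R (add_mset c (add_mset a (add_mset b N)))"
    using ab(4) by (simp add: add_mset_commute)
  from scale[OF this, of "2 powi k"]
  have "R (add_mset a (add_mset b (add_mset ((2 powi k) ^ 4 * c) N)))"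
    by (simp add: add_mset_commute)
  moreover have "rel_mset val_eq (add_mset (v + 4 * k) W) (add_mset ((2 powi k) ^ 4 * c) N)"
    using rel_mset_Plus[of val_eq, OF val_eq_scale[OF ab(5)] ab(6)] by simp
  ultimately show ?thesis
    using ab(1-3) unfolding opposite_def by blast
qed

lemma opposite_imp_realizes_free:
  assumes "opposite w W"
  obtains "realizes_free (w + 4) (w + 2) W" | "realizes_free (w + 4) (w + 3) W"
proof -
  obtain a b N where ab: "val_eq w a" "val_ge (w + 2) (a + b)"
      "R (add_mset a (add_mset b N))" "rel_mset val_eq W N"
    using assms unfolding opposite_def by blast
  have free: "free (w + 4) (a + b) N"
    using free_merge[OF free_start[OF ab(3,1)]] by simp
  obtain w' where "val_eq w' (a + b)" "w + 2 \<le> w'" "w' < w + 4"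
    using free ab(2) by (rule free_val_eq)
  moreover from this have "w' = w + 2 \<or> w' = w + 3"
    by linarith
  ultimately show ?thesis
    using that free ab(4) unfolding realizes_free_def by blast
qed

lemma pair_cases:
  assumes "val_eq w a" "val_eq w b"
  obtains "val_eq (w + 1) (a + b)" | "val_ge (w + 2) (a + b)"
  using val_ge_cases[OF val_eq_add_val_eq[OF assms]] by (simp add: add.assoc) metis

text \<open>If \<open>a + b\<close> has valuation exactly \<open>w + 1\<close>, the third value
  \<open>c\<close> repairs it: \<open>a + c\<close> still has valuation \<open>w\<close>, and (a +
  b) + c is a sum of two numbers of valuation \<open>w + 1\<close>.\<close>

lemma opposite_of_flip:
  assumes "realizes (add_mset w (add_mset w (add_mset (w + 1) W)))"
  shows "opposite w W"
proof -
  obtain a b c N where ab: "val_eq w a" "val_eq w b" and c: "val_eq (w + 1) c"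
    and R: "R (add_mset a (add_mset b (add_mset c N)))" and N: "rel_mset val_eq W N"
    using assms msed_rel_invL unfolding realizes_def by metis
  show ?thesis
  proof (rule pair_cases[OF ab])
    assume "val_ge (w + 2) (a + b)"
    moreover have "R (add_mset c (add_mset a (add_mset b N)))"
      using R by (simp add: add_mset_commute)
    ultimately show ?thesis
      using ab N drop unfolding opposite_def by blast
  next
    assume sum: "val_eq (w + 1) (a + b)"
    have "R (add_mset a (add_mset c (add_mset b N)))"
      using R by (simp add: add_mset_commute)
    hence "R (add_mset (a + c) (add_mset b N))"
      by (rule merge)
    moreover have "val_eq w (a + c)"
      using ab(1) val_eq_imp_val_ge[OF c] by (rule val_eq_add_val_ge)
    moreover have "val_ge (w + 2) (a + c + b)"
      using val_eq_add_val_eq[OF sum c] by (simp add: ac_simps)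
    ultimately show ?thesis
      using ab(2) N unfolding opposite_def by blast
  qed
qed

text \<open>
  Among three numbers of valuation \<open>w\<close> two have a sum of valuation exactly \<open>w + 1\<close>: otherwise
  \<open>2a = (a + b) + (a + c) - (b + c)\<close> would have valuation at least \<open>w + 2\<close>.
\<close>

lemma realizes_triple:
  assumes "realizes (add_mset w (add_mset w (add_mset w W)))"
  shows "realizes (add_mset w (add_mset (w + 1) W))"
proof -
  obtain a b c N where abc: "val_eq w a" "val_eq w b" "val_eq w c"
    and R: "R (add_mset a (add_mset b (add_mset c N)))" and N: "rel_mset val_eq W N"
    using assms msed_rel_invL unfolding realizes_def by metis
  have step: ?thesis if "val_eq (w + 1) (x + y)" "R (add_mset x (add_mset y (add_mset z N)))" "val_eq w z"
    for x y z
    using realizesI[OF that(1) merge[OF that(2)] rel_mset_Plus[of val_eq, OF that(3) N]]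
    by (simp add: add_mset_commute)
  show ?thesis
  proof (rule ccontr)
    assume contr: "\<not> ?thesis"
    have "val_ge (w + 2) (a + b)"
      by (rule pair_cases[OF abc(1,2)]) (use contr step[OF _ _ abc(3)] R in auto)
    moreover have "val_ge (w + 2) (a + c)"
      by (rule pair_cases[OF abc(1,3)])
        (use contr step[of a c b, OF _ _ abc(2)] R in \<open>auto simp: add_mset_commute\<close>)
    moreover have "val_ge (w + 2) (b + c)"
      by (rule pair_cases[OF abc(2,3)])
        (use contr step[of b c a, OF _ _ abc(1)] R in \<open>auto simp: add_mset_commute\<close>)
    ultimately have "val_ge (w + 2) ((a + b) + (a + c) - (b + c))"
      by (intro val_ge_diff[OF val_ge_add])
    hence "val_ge (w + 2) (a + a)"
      by (simp add: algebra_simps)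
    thus False
      using val_eq_imp_not_val_ge[OF val_eq_double[OF abc(1)], of "w + 2"] by simp
  qed
qed

text \<open>Two pairs can exchange roles: if the second pair does not merge to \<open>v + 1\<close>,
  it is opposite itself, and the first one is released as two ordinary values.\<close>

lemma opposite_pair_cases:
  assumes "opposite w (add_mset v (add_mset v W))"
  obtains "opposite w (add_mset (v + 1) W)" | "opposite v (add_mset w (add_mset w W))"
proof -
  obtain a b x y N where ab: "val_eq w a" "val_eq w b" "val_ge (w + 2) (a + b)"
    and xy: "val_eq v x" "val_eq v y" and N: "rel_mset val_eq W N"
    and R: "R (add_mset a (add_mset b (add_mset x (add_mset y N))))"
    using assms msed_rel_invL unfolding opposite_def by metis
  have R': "R (add_mset x (add_mset y (add_mset a (add_mset b N))))"
    using R by (simp add: add_mset_commute)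
  show ?thesis
  proof (rule pair_cases[OF xy])
    assume "val_eq (v + 1) (x + y)"
    moreover have "R (add_mset a (add_mset b (add_mset (x + y) N)))"
      using merge[OF R'] by (simp add: add_mset_commute)
    ultimately have "opposite w (add_mset (v + 1) W)"
      using ab rel_mset_Plus[of val_eq, OF _ N] unfolding opposite_def by blast
    thus ?thesis
      by (rule that)
  next
    assume "val_ge (v + 2) (x + y)"
    moreover have "rel_mset val_eq (add_mset w (add_mset w W)) (add_mset a (add_mset b N))"
      using ab N by (intro rel_mset_Plus)
    ultimately have "opposite v (add_mset w (add_mset w W))"
      using R' xy unfolding opposite_def by blast
    thus ?thesis
      by (rule that)
  qed
qed

lemma not_realizes_free_3: "\<not> realizes_free (s + 4) (s + 3) (add_mset (s + 3) W)"
  by (rule notI, erule realizes_free_climb) simp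

lemma not_realizes_free_2: "\<not> realizes_free (s + 4) (s + 2) (add_mset (s + 2) (add_mset (s + 3) W))"
proof
  assume "realizes_free (s + 4) (s + 2) (add_mset (s + 2) (add_mset (s + 3) W))"
  then obtain w where "s + 2 < w" "w < s + 4" "realizes_free (s + 4) w (add_mset (s + 3) W)"
    by (rule realizes_free_climb)
  moreover from this have "w = s + 3"
    by simp
  ultimately show False
    using not_realizes_free_3 by blast
qed

text \<open>The first merge may jump to \<open>s + 1\<close>, \<open>s + 2\<close> or
  \<open>s + 3\<close>, and so may the later ones, but wherever the chain lands below
  \<open>s + 4\<close>, a value of that valuation is waiting.\<close>

lemma not_realizes_four_classes_twice: "\<not> realizes {#s, s, s + 1, s + 2, s + 3#}"
proof
  assume "realizes {#s, s, s + 1, s + 2, s + 3#}"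
  hence "realizes_free (s + 4) s {#s, s + 1, s + 2, s + 3#}"
    using realizes_free_start[of s] by simp
  then obtain w where w: "s < w" "w < s + 4" "realizes_free (s + 4) w {#s + 1, s + 2, s + 3#}"
    by (rule realizes_free_climb)
  have two: "w \<noteq> s + 2" if "realizes_free (s + 4) w (add_mset (s + 2) (add_mset (s + 3) W))" for w W
    using that not_realizes_free_2 by blast
  have three: "w \<noteq> s + 3" if "realizes_free (s + 4) w (add_mset (s + 3) W)" for w W
    using that not_realizes_free_3 by blast
  have "w \<noteq> s + 2" "w \<noteq> s + 3"
    using w(3) two[of w "{#s + 1#}"] three[of w "{#s + 1, s + 2#}"] by (auto simp: add_mset_commute)
  hence "w = s + 1"
    using w by simp
  then obtain w' where w': "s + 1 < w'" "w' < s + 4" "realizes_free (s + 4) w' {#s + 2, s + 3#}"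
    using w(3) by (auto elim: realizes_free_climb)
  moreover have "w' \<noteq> s + 2" "w' \<noteq> s + 3"
    using w'(3) two[of w' "{#}"] three[of w' "{#s + 2#}"] by (auto simp: add_mset_commute)
  ultimately show False
    by simp
qed

text \<open>A further value repeats one of the classes. Shifting the smaller valuations by 4 makes
  the repeated class the lowest one.\<close>

lemma not_realizes_four_classes: "\<not> realizes {#s, s + 1, s + 2, s + 3#}"
proof
  assume "realizes {#s, s + 1, s + 2, s + 3#}"
  then obtain x where x: "realizes (add_mset x {#s, s + 1, s + 2, s + 3#})" "s \<le> x" "x < s + 4"
    by (rule realizes_extend[where s = s]) simp_all
  have shift: "realizes (add_mset (w + 4) W)" if "realizes (add_mset w W)" for w W
    using realizes_shift[OF that, of 1] by simp
  consider "x = s" | "x = s + 1" | "x = s + 2" | "x = s + 3"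
    using x(2,3) by linarith
  thus False
  proof cases
    case 1
    thus False
      using x(1) not_realizes_four_classes_twice[of s] by simp
  next
    case 2
    hence "realizes (add_mset s {#s + 1, s + 1, s + 2, s + 3#})"
      using x(1) by (simp add: add_mset_commute)
    from shift[OF this] show False
      using not_realizes_four_classes_twice[of "s + 1"] by (simp add: add_mset_commute add.assoc)
  next
    case 3
    hence "realizes (add_mset s (add_mset (s + 1) {#s + 2, s + 2, s + 3#}))"
      using x(1) by (simp add: add_mset_commute)
    from shift[OF this] have "realizes (add_mset (s + 1) (add_mset (s + 4) {#s + 2, s + 2, s + 3#}))"
      by (simp add: add_mset_commute add.assoc)
    from shift[OF this] show False
      using not_realizes_four_classes_twice[of "s + 2"] by (simp add: add_mset_commute add.assoc)
  next
    case 4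
    hence "realizes (add_mset s (add_mset (s + 1) {#s + 2, s + 3, s + 3#}))"
      using x(1) by (simp add: add_mset_commute)
    from shift[OF this] have "realizes (add_mset (s + 1) (add_mset (s + 4) {#s + 2, s + 3, s + 3#}))"
      by (simp add: add_mset_commute add.assoc)
    from shift[OF this] have "realizes (add_mset (s + 2) (add_mset (s + 5) (add_mset (s + 4) {#s + 3, s + 3#})))"
      by (simp add: add_mset_commute add.assoc)
    from shift[OF this] show False
      using not_realizes_four_classes_twice[of "s + 3"] by (simp add: add_mset_commute add.assoc)
  qed
qed

lemma not_opposite: "\<not> opposite w (add_mset (w + 2) (add_mset (w + 3) W))"
proof
  assume "opposite w (add_mset (w + 2) (add_mset (w + 3) W))"
  thus False
  proof (rule opposite_imp_realizes_free)
    assume "realizes_free (w + 4) (w + 3) (add_mset (w + 2) (add_mset (w + 3) W))"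
    hence "realizes_free (w + 4) (w + 3) (add_mset (w + 3) (add_mset (w + 2) W))"
      by (simp only: add_mset_commute)
    thus False
      by (simp add: not_realizes_free_3)
  qed (simp add: not_realizes_free_2)
qed

text \<open>
  One of the values of valuation \<open>s + 2\<close> is spent to make the values of valuation \<open>s + 1\<close> opposite.
  This frees a place for one more value.
\<close>

lemma not_realizes_two_two_two: "\<not> realizes {#s, s, s + 1, s + 1, s + 2, s + 2#}"
proof
  assume "realizes {#s, s, s + 1, s + 1, s + 2, s + 2#}"
  hence "realizes (add_mset (s + 1) (add_mset (s + 1) (add_mset (s + 1 + 1) {#s, s, s + 2#})))"
    by (simp add: add_mset_commute add.assoc)
  hence "opposite (s + 1) {#s, s, s + 2#}"
    by (rule opposite_of_flip)
  then obtain x where x: "opposite (s + 1) {#x, s, s, s + 2#}" "s \<le> x" "x < s + 4"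
    by (rule opposite_extend[where s = s]) simp_all
  \<comment> \<open>With the opposite pair at \<open>w\<close>, the two values of valuation
    \<open>w - 1\<close> are shifted to \<open>w + 3\<close>. There they rule out that the pair sums
    to valuation \<open>w + 3\<close>, so its sum must have valuation \<open>w + 2\<close>.\<close>
  define w where "w = s + 1"
  have "opposite w {#w - 1, x, w - 1, w + 1#}"
    using x(1) by (simp add: w_def add_mset_commute add.assoc)
  from opposite_shift[OF this, of 1] have "opposite w {#w - 1, w + 3, x, w + 1#}"
    by (simp add: add_mset_commute add.commute[of 3])
  from opposite_shift[OF this, of 1] have opp: "opposite w {#x, w + 3, w + 3, w + 1#}"
    by (simp add: add_mset_commute add.commute[of 3])
  have "w - 1 \<le> x" "x < w + 3"
    using x(2,3) by (simp_all add: w_def)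
  then consider "x = w - 1" | "x = w" | "x = w + 1" | "x = w + 2"
    by linarith
  thus False
  proof cases
    case 1
    have opp': "opposite w {#w + 3, w + 3, w + 3, w + 1#}"
      using opposite_shift[of w x "{#w + 3, w + 3, w + 1#}" 1] opp 1 by (simp add: add.commute[of 3])
    show False
    proof (rule opposite_imp_realizes_free[OF opp'])
      assume "realizes_free (w + 4) (w + 2) {#w + 3, w + 3, w + 3, w + 1#}"
      hence "realizes {#w + 3, w + 3, w + 3, w + 1, w + 2#}"
        by (drule_tac realizes_free_imp) (simp add: add_mset_commute)
      \<comment> \<open>Three values at \<open>w + 3\<close> yield one at \<open>w + 4\<close>,
        which stands in for the missing class of \<open>w\<close>.\<close>
      from realizes_triple[OF this] have "realizes (add_mset (w + 4) {#w + 1, w + 2, w + 3#})"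
        by (simp add: add_mset_commute add.assoc)
      from realizes_shift[OF this, of "- 1"] show False
        using not_realizes_four_classes[of w] by simp
    qed (simp add: not_realizes_free_3)
  next
    case 2
    show False
    proof (rule opposite_imp_realizes_free[OF opp])
      assume "realizes_free (w + 4) (w + 2) {#x, w + 3, w + 3, w + 1#}"
      hence "realizes (add_mset (w + 3) {#w, w + 1, w + 2, w + 3#})"
        using 2 by (drule_tac realizes_free_imp) (simp add: add_mset_commute)
      thus False
        using realizes_drop not_realizes_four_classes by blast
    next
      assume "realizes_free (w + 4) (w + 3) {#x, w + 3, w + 3, w + 1#}"
      thus False
        using not_realizes_free_3[of w "{#x, w + 3, w + 1#}"] by (simp add: add_mset_commute)
    qed
  next
    case 3
    hence "opposite w (add_mset (w + 1) (add_mset (w + 1) {#w + 3, w + 3#}))"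
      using opp by (simp add: add_mset_commute)
    thus False
    proof (rule opposite_pair_cases)
      assume "opposite w (add_mset (w + 1 + 1) {#w + 3, w + 3#})"
      thus False
        using not_opposite[of w "{#w + 3#}"] by (simp add: add.assoc)
    next
      \<comment> \<open>Counted from the new opposite pair at \<open>w + 1\<close>, the valuations
        \<open>w + 3\<close> and \<open>w + 4\<close> are the two required ones; the latter comes
        from the released pair.\<close>
      assume "opposite (w + 1) (add_mset w (add_mset w {#w + 3, w + 3#}))"
      from opposite_shift[OF this, of 1]
      have "opposite (w + 1) (add_mset (w + 1 + 2) (add_mset (w + 1 + 3) {#w, w + 3#}))"
        by (simp add: add_mset_commute add.assoc)
      thus False
        by (simp only: not_opposite)
    qed
  next
    case 4
    thus False
      using opp not_opposite[of w "{#w + 3, w + 1#}"] by simp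
  qed
qed

text \<open>Counts of values in three consecutive classes. The class of \<open>s + 3\<close> is left
  out: as soon as all three counts are positive, it cannot occur any more.\<close>

definition triple :: "int \<Rightarrow> nat \<Rightarrow> nat \<Rightarrow> nat \<Rightarrow> bool" where
  "triple s i j k \<longleftrightarrow> realizes (replicate_mset i s + replicate_mset j (s + 1) + replicate_mset k (s + 2))"

lemma triple_mono:
  assumes "triple s i j k" "i' \<le> i" "j' \<le> j" "k' \<le> k"
  shows "triple s i' j' k'"
proof -
  have "replicate_mset n' (x :: int) \<subseteq># replicate_mset n x" if "n' \<le> n" for n n' x
    using that by (simp add: subseteq_mset_def)
  thus ?thesis
    using assms(2-4) unfolding triple_def
    by (intro realizes_subset[OF assms(1)[unfolded triple_def]] subset_mset.add_mono) simp_all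
qed

lemma triple_merge_0: "triple s (Suc (Suc (Suc i))) j k \<Longrightarrow> triple s (Suc i) (Suc j) k"
  using realizes_triple[of s "replicate_mset i s + replicate_mset j (s + 1) + replicate_mset k (s + 2)"]
  by (simp add: triple_def add_mset_commute)

lemma triple_merge_1: "triple s i (Suc (Suc (Suc j))) k \<Longrightarrow> triple s i (Suc j) (Suc k)"
  using realizes_triple[of "s + 1" "replicate_mset i s + replicate_mset j (s + 1) + replicate_mset k (s + 2)"]
  by (simp add: triple_def add.assoc add_mset_commute)

lemma not_triple_merge_2: "\<not> triple s (Suc i) (Suc j) (Suc (Suc (Suc k)))"
proof
  assume "triple s (Suc i) (Suc j) (Suc (Suc (Suc k)))"
  hence "triple s 1 1 3"
    by (rule triple_mono) simp_all
  hence "realizes (add_mset (s + 2) (add_mset (s + 2) (add_mset (s + 2) {#s, s + 1#})))"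
    by (simp add: triple_def numeral_eq_Suc add_mset_commute)
  from realizes_triple[OF this] show False
    using not_realizes_four_classes[of s] by (simp add: add_mset_commute add.assoc)
qed

lemma not_triple_2_2_2: "\<not> triple s 2 2 2"
  using not_realizes_two_two_two[of s] by (simp add: triple_def numeral_eq_Suc add_mset_commute)

lemma triple_extend:
  assumes "triple s i j k" "i + j + k < 6"
  obtains "triple s (Suc i) j k" | "triple s i (Suc j) k" | "triple s i j (Suc k)"
    | "realizes (add_mset (s + 3) (replicate_mset i s + replicate_mset j (s + 1) + replicate_mset k (s + 2)))"
proof -
  obtain x where x: "realizes (add_mset x (replicate_mset i s + replicate_mset j (s + 1) + replicate_mset k (s + 2)))"
      "s \<le> x" "x < s + 4"
    using assms by (auto simp: triple_def elim: realizes_extend[where s = s])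
  consider "x = s" | "x = s + 1" | "x = s + 2" | "x = s + 3"
    using x(2,3) by linarith
  thus ?thesis
    using x(1) that by cases (simp_all add: triple_def)
qed

lemma triple_extend_full:
  assumes "triple s i j k" "i + j + k < 6" "i > 0" "j > 0" "k > 0"
  obtains "triple s (Suc i) j k" | "triple s i (Suc j) k" | "triple s i j (Suc k)"
proof (rule triple_extend[OF assms(1,2)])
  assume *: "realizes (add_mset (s + 3) (replicate_mset i s + replicate_mset j (s + 1) + replicate_mset k (s + 2)))"
  have "{#s, s + 1, s + 2, s + 3#}
      \<subseteq># add_mset (s + 3) (replicate_mset i s + replicate_mset j (s + 1) + replicate_mset k (s + 2))"
    using assms(3-5) by (auto simp: subseteq_mset_def)
  thus ?thesis
    using realizes_subset[OF *] not_realizes_four_classes by blast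
qed

text \<open>Extensions stay within the three classes, so the counts are excluded from the largest
  downwards: a configuration is impossible if all its extensions are, or if merging three values of
  a class leads to an impossible one. Of the configurations with six values and no empty class, only
  \<open>2 2 2\<close> has no class with three values, which is why it needs an argument of its
  own.\<close>

lemma not_triple_1_1_1: "\<not> triple s 1 1 1"
proof -
  have n113: "\<not> triple s 1 1 3" and n213: "\<not> triple s 2 1 3" and n123: "\<not> triple s 1 2 3"
    using not_triple_merge_2[of s 0 0 0] not_triple_merge_2[of s 1 0 0] not_triple_merge_2[of s 0 1 0]
    by (simp_all add: numeral_eq_Suc)
  have n132: "\<not> triple s 1 3 2"
    using triple_merge_1[of s 1 0 2] n113 by (auto simp: numeral_eq_Suc)
  have n122: "\<not> triple s 1 2 2"
    using triple_extend_full[of s 1 2 2] not_triple_2_2_2[of s] n132 n123 by (auto simp: numeral_eq_Suc)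
  have n312: "\<not> triple s 3 1 2"
    using triple_merge_0[of s 0 1 2] n122 by (auto simp: numeral_eq_Suc)
  have n212: "\<not> triple s 2 1 2"
    using triple_extend_full[of s 2 1 2] not_triple_2_2_2[of s] n312 n213 by (auto simp: numeral_eq_Suc)
  have n112: "\<not> triple s 1 1 2"
    using triple_extend_full[of s 1 1 2] n212 n122 n113 by (auto simp: numeral_eq_Suc)
  have n131: "\<not> triple s 1 3 1"
    using triple_merge_1[of s 1 0 1] n112 by (auto simp: numeral_eq_Suc)
  have n321: "\<not> triple s 3 2 1"
    using triple_merge_0[of s 0 2 1] n131 by (auto simp: numeral_eq_Suc)
  have n231: "\<not> triple s 2 3 1" and n222: "\<not> triple s 2 2 2"
    using triple_mono[of s 2 3 1 1 3 1] n131 not_triple_2_2_2 by auto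
  have n221: "\<not> triple s 2 2 1"
    using triple_extend_full[of s 2 2 1] n321 n231 n222 by (auto simp: numeral_eq_Suc)
  have n121: "\<not> triple s 1 2 1"
    using triple_extend_full[of s 1 2 1] n221 n131 n122 by (auto simp: numeral_eq_Suc)
  have n311: "\<not> triple s 3 1 1"
    using triple_merge_0[of s 0 1 1] n121 by (auto simp: numeral_eq_Suc)
  have n211: "\<not> triple s 2 1 1"
    using triple_extend_full[of s 2 1 1] n311 n221 n212 by (auto simp: numeral_eq_Suc)
  show ?thesis
    using triple_extend_full[of s 1 1 1] n211 n121 n112 by (auto simp: numeral_eq_Suc)
qed

lemma not_realizes_three_classes: "\<not> realizes (add_mset s (add_mset (s + 1) (add_mset (s + 2) W)))"
proof
  assume *: "realizes (add_mset s (add_mset (s + 1) (add_mset (s + 2) W)))"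
  have "realizes {#s, s + 1, s + 2#}"
    by (rule realizes_subset[OF *]) simp
  thus False
    using not_triple_1_1_1[of s] by (simp add: triple_def add_mset_commute)
qed

text \<open>A value outside the two classes would complete three consecutive ones, at
  \<open>s + 2\<close> directly and at \<open>s + 3\<close> after a shift to \<open>s - 1\<close>.
  So the two classes fill up until one has three values to merge.\<close>

lemma not_triple_1_1_0: "\<not> triple s 1 1 0"
proof -
  have ext: "triple s (Suc i) j 0 \<or> triple s i (Suc j) 0" if "triple s i j 0" "i + j < 6" "i > 0" "j > 0" for i j
  proof (rule triple_extend[OF that(1)])
    assume "triple s i j (Suc 0)"
    hence "triple s 1 1 1"
      by (rule triple_mono) (use that in simp_all)
    thus ?thesis
      using not_triple_1_1_1 by blast
  next
    assume *: "realizes (add_mset (s + 3) (replicate_mset i s + replicate_mset j (s + 1) + replicate_mset 0 (s + 2)))"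
    have "realizes (add_mset (s + 3) {#s, s + 1#})"
      by (rule realizes_subset[OF *]) (use that in \<open>auto simp: subseteq_mset_def\<close>)
    from realizes_shift[OF this, of "- 1"] show ?thesis
      using not_realizes_three_classes[of "s - 1" "{#}"] by (simp add: algebra_simps)
  qed (use that in auto)
  have n130: "\<not> triple s 1 3 0"
    using triple_merge_1[of s 1 0 0] not_triple_1_1_1[of s] by (auto simp: numeral_eq_Suc)
  have n320: "\<not> triple s 3 2 0"
    using triple_merge_0[of s 0 2 0] n130 by (auto simp: numeral_eq_Suc)
  have n230: "\<not> triple s 2 3 0"
    using triple_mono[of s 2 3 0 1 3 0] n130 by auto
  have n220: "\<not> triple s 2 2 0"
    using ext[of 2 2] n320 n230 by (auto simp: numeral_eq_Suc)
  have n120: "\<not> triple s 1 2 0"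
    using ext[of 1 2] n220 n130 by (auto simp: numeral_eq_Suc)
  have n310: "\<not> triple s 3 1 0"
    using triple_merge_0[of s 0 1 0] n120 by (auto simp: numeral_eq_Suc)
  have n210: "\<not> triple s 2 1 0"
    using ext[of 2 1] n310 n220 by (auto simp: numeral_eq_Suc)
  show ?thesis
    using ext[of 1 1] n210 n120 by (auto simp: numeral_eq_Suc)
qed

text \<open>Modulo 4 the classes of \<open>s\<close> and \<open>s + 2\<close> are two apart in
  either direction, since \<open>s + 4\<close> represents the class of \<open>s\<close>.\<close>

lemma triple_swap:
  assumes "triple s i 0 k"
  shows "triple (s + 2) k 0 i"
proof -
  have "realizes (U + replicate_mset i (s + 4))" if "realizes (U + replicate_mset i s)" for U
    using that
  proof (induction i arbitrary: U)
    case (Suc i)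
    have "realizes (add_mset (s + 4) U + replicate_mset i s)"
      using realizes_shift[of s "U + replicate_mset i s" 1] Suc.prems by simp
    from Suc.IH[OF this] show ?case
      by simp
  qed simp
  thus ?thesis
    using assms by (simp add: triple_def add.commute[of "replicate_mset i s"] add.assoc)
qed

text \<open>Both missing classes lie between the two given ones in the cyclic order, so a value in
  either completes three consecutive classes; so does merging three values of one class.\<close>

lemma not_triple_1_0_1: "\<not> triple s 1 0 1"
proof -
  have ext: "triple s (Suc i) 0 k \<or> triple s i 0 (Suc k)" if "triple s i 0 k" "i + k < 6" "i > 0" "k > 0" for s i k
  proof (rule triple_extend[OF that(1)])
    assume "triple s i (Suc 0) k"
    hence "triple s 1 1 1"
      by (rule triple_mono) (use that in simp_all)
    thus ?thesis
      using not_triple_1_1_1 by blast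
  next
    assume *: "realizes (add_mset (s + 3) (replicate_mset i s + replicate_mset 0 (s + 1) + replicate_mset k (s + 2)))"
    have "realizes (add_mset s {#s + 2, s + 3#})"
      by (rule realizes_subset[OF *]) (use that in \<open>auto simp: subseteq_mset_def\<close>)
    from realizes_shift[OF this, of 1] show ?thesis
      using not_realizes_three_classes[of "s + 2" "{#}"] by (simp add: add_mset_commute add.assoc)
  qed (use that in auto)
  \<comment> \<open>The general \<open>s\<close> and \<open>k\<close> serve the swap, which turns
    \<open>2 0 3\<close> at \<open>s\<close> into \<open>3 0 2\<close> at
    \<open>s + 2\<close>.\<close>
  have n301: "\<not> triple s 3 0 k" if "k > 0" for s k
    using triple_merge_0[of s 0 0 k] triple_mono[of s 1 1 k 1 1 1] not_triple_1_1_1[of s] that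
    by (auto simp: numeral_eq_Suc)
  have n203: "\<not> triple s 2 0 3" for s
    using triple_swap[of s 2 3] n301[of 2] by auto
  have n202: "\<not> triple s 2 0 2" for s
    using ext[of s 2 2] n301[of 2 s] n203[of s] by (auto simp: numeral_eq_Suc)
  have n201: "\<not> triple s 2 0 1" for s
    using ext[of s 2 1] n301[of 1 s] n202[of s] by (auto simp: numeral_eq_Suc)
  show ?thesis
    using ext[of s 1 1] n201 triple_swap[of s 1 2] by (auto simp: numeral_eq_Suc)
qed

text \<open>Two different classes can no longer coexist, so every extension repeats the first class.
  But three values of one class merge into two neighbouring classes.\<close>

theorem contradiction: False
proof -
  have start: "realizes {#}"
    using empty unfolding realizes_def by auto
  obtain s where s: "realizes {#s#}"
    by (rule realizes_extend[OF start, of 0]) simp_all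
  have ext: "triple s (Suc i) 0 0" if "triple s i 0 0" "0 < i" "i < 6" for i
  proof (rule triple_extend[OF that(1)])
    assume "triple s i (Suc 0) 0"
    hence "triple s 1 1 0"
      by (rule triple_mono) (use that in simp_all)
    thus ?thesis
      using not_triple_1_1_0 by blast
  next
    assume "triple s i 0 (Suc 0)"
    hence "triple s 1 0 1"
      by (rule triple_mono) (use that in simp_all)
    thus ?thesis
      using not_triple_1_0_1 by blast
  next
    assume *: "realizes (add_mset (s + 3) (replicate_mset i s + replicate_mset 0 (s + 1) + replicate_mset 0 (s + 2)))"
    have "realizes (add_mset s {#s + 3#})"
      by (rule realizes_subset[OF *]) (use that in \<open>auto simp: subseteq_mset_def\<close>)
    from realizes_shift[OF this, of 1] have "triple (s + 3) 1 1 0"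
      by (simp add: triple_def add_mset_commute add.assoc)
    thus ?thesis
      using not_triple_1_1_0 by blast
  qed (use that in auto)
  have "triple s 3 0 0"
    using ext[of 1] ext[of 2] s by (simp add: triple_def numeral_eq_Suc)
  hence "triple s 1 1 0"
    using triple_merge_0[of s 0 0 0] by (simp add: numeral_eq_Suc)
  thus False
    using not_triple_1_1_0 by simp
qed

end

section \<open>Symmetric multilinear forms\<close>

locale form_space = vector_space scale
  for scale :: "'a :: field \<Rightarrow> 'b :: ab_group_add \<Rightarrow> 'b"
begin

text \<open>
  A symmetric \<open>d\<close>-linear form is a function of the multiset of its arguments; its values on
  multisets of a size other than \<open>d\<close> are irrelevant.
\<close>

definition sym_form :: "nat \<Rightarrow> ('b multiset \<Rightarrow> 'a) \<Rightarrow> bool" where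
  "sym_form d M \<longleftrightarrow> (\<forall>U. Suc (size U) = d \<longrightarrow>
     (\<forall>x y. M (add_mset (x + y) U) = M (add_mset x U) + M (add_mset y U)) \<and>
     (\<forall>c x. M (add_mset (scale c x) U) = c * M (add_mset x U)))"

text \<open>By multilinearity the form then vanishes on the whole span of \<open>D\<close>.\<close>

definition null_on :: "nat \<Rightarrow> ('b multiset \<Rightarrow> 'a) \<Rightarrow> 'b set \<Rightarrow> bool" where
  "null_on d M D \<longleftrightarrow> (\<forall>U\<in>multisets_of_size D d. M U = 0)"

definition diagonal_on :: "nat \<Rightarrow> ('b multiset \<Rightarrow> 'a) \<Rightarrow> 'b set \<Rightarrow> bool" where
  "diagonal_on d M D \<longleftrightarrow> (\<forall>U\<in>multisets_of_size D d. (\<forall>x. U \<noteq> replicate_mset d x) \<longrightarrow> M U = 0)"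

lemma sym_form_linear:
  "sym_form d M \<Longrightarrow> Suc (size U) = d \<Longrightarrow>
   M (add_mset (scale s x + scale t y) U) = s * M (add_mset x U) + t * M (add_mset y U)"
  by (simp add: sym_form_def)

lemma sym_form_zero: "sym_form d M \<Longrightarrow> Suc (size U) = d \<Longrightarrow> M (add_mset 0 U) = 0"
  using sym_form_linear[of d M U 0 0 0 0] by simp

lemma sym_form_lower: "sym_form (size U + d) M \<Longrightarrow> sym_form d (\<lambda>W. M (W + U))"
  by (auto simp: sym_form_def)

lemma null_on_subset: "null_on d M D \<Longrightarrow> D' \<subseteq> D \<Longrightarrow> null_on d M D'"
  using multisets_of_size_mono[of D' D d] by (auto simp: null_on_def)

lemma diagonal_on_subset: "diagonal_on d M D \<Longrightarrow> D' \<subseteq> D \<Longrightarrow> diagonal_on d M D'"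
  using multisets_of_size_mono[of D' D d] by (auto simp: diagonal_on_def)

lemma diagonal_onD:
  assumes "diagonal_on d M D" "set_mset U \<subseteq> D" "size U = d" "x \<in># U" "y \<in># U" "x \<noteq> y"
  shows "M U = 0"
proof -
  have "U \<noteq> replicate_mset d z" for z
    using assms(4-6) by (auto split: if_splits)
  thus ?thesis
    using assms(1-3) by (auto simp: diagonal_on_def multisets_of_size_def)
qed

lemma split_off_mset:
  assumes "U \<in> multisets_of_size (insert x D) d"
  obtains j U' where "U = replicate_mset j x + U'" "j + size U' = d" "set_mset U' \<subseteq> D - {x}"
proof -
  define U' where "U' = filter_mset (\<lambda>y. y \<noteq> x) U"
  have U: "U = replicate_mset (count U x) x + U'"
    by (rule multiset_eqI) (simp add: U'_def)
  hence "count U x + size U' = d"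
    using assms by (metis multisets_of_size_size size_replicate_mset size_union)
  moreover have "set_mset U' \<subseteq> D - {x}"
    using assms by (auto simp: U'_def multisets_of_size_def)
  ultimately show ?thesis
    using U that by blast
qed

lemma null_on_insert:
  assumes "null_on d M D"
    and "\<And>j U. 0 < j \<Longrightarrow> j \<le> d \<Longrightarrow> U \<in> multisets_of_size D (d - j) \<Longrightarrow> M (replicate_mset j x + U) = 0"
  shows "null_on d M (insert x D)"
  unfolding null_on_def
proof
  fix U assume "U \<in> multisets_of_size (insert x D) d"
  then obtain j U' where U: "U = replicate_mset j x + U'" "j + size U' = d" "set_mset U' \<subseteq> D - {x}"
    by (rule split_off_mset)
  hence "U' \<in> multisets_of_size D (d - j)"
    by (auto simp: multisets_of_size_def)
  thus "M U = 0"
    using assms U(1,2) by (cases "j = 0") (auto simp: null_on_def)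
qed

lemma diagonal_on_insert:
  assumes "diagonal_on d M D"
    and "\<And>j U. 0 < j \<Longrightarrow> j < d \<Longrightarrow> U \<in> multisets_of_size D (d - j) \<Longrightarrow> M (replicate_mset j x + U) = 0"
  shows "diagonal_on d M (insert x D)"
  unfolding diagonal_on_def
proof (intro ballI impI)
  fix U assume "U \<in> multisets_of_size (insert x D) d"
  then obtain j U' where U: "U = replicate_mset j x + U'" "j + size U' = d" "set_mset U' \<subseteq> D - {x}"
    by (rule split_off_mset)
  assume non: "\<forall>x. U \<noteq> replicate_mset d x"
  have U': "U' \<in> multisets_of_size D (d - j)"
    using U(2,3) by (auto simp: multisets_of_size_def)
  have "j \<noteq> d"
  proof
    assume "j = d"
    hence "U = replicate_mset d x"
      using U(1,2) by simp
    thus False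
      using non by blast
  qed
  show "M U = 0"
  proof (cases "j = 0")
    case True
    thus ?thesis
      using assms(1) U(1) U' non by (simp add: diagonal_on_def)
  next
    case False
    thus ?thesis
      using assms(2)[of j U'] U(1,2) U' \<open>j \<noteq> d\<close> by simp
  qed
qed

lemma null_on_combination:
  assumes M: "sym_form d M" and D: "null_on d M D" "x \<in> D" "y \<in> D"
  shows "null_on d M (insert (scale s x + scale t y) D)"
proof -
  let ?z = "scale s x + scale t y"
  have *: "M (replicate_mset n ?z + U) = 0" if "set_mset U \<subseteq> D" "n + size U = d" for n U
    using that
  proof (induction n arbitrary: U)
    case 0
    thus ?case
      using D(1) by (simp add: null_on_def multisets_of_size_def)
  next
    case (Suc n)
    have "M (replicate_mset n ?z + add_mset w U) = 0" if "w \<in> D" for w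
      using Suc.IH[of "add_mset w U"] Suc.prems that by simp
    from this[OF D(2)] this[OF D(3)] show ?case
      using Suc.prems by (simp add: sym_form_linear[OF M])
  qed
  show ?thesis
    using D(1) by (rule null_on_insert) (use * in \<open>auto simp: multisets_of_size_def\<close>)
qed

lemma diagonal_on_combination:
  assumes M: "sym_form d M" and D: "diagonal_on d M D" "x \<in> D" "y \<in> D"
  shows "diagonal_on d M (insert (scale s x + scale t y) (D - {x, y}))"
proof -
  let ?z = "scale s x + scale t y"
  \<comment> \<open>Expanding \<open>?z\<close> adds copies of \<open>x\<close> and \<open>y\<close>
    to \<open>U\<close>, so \<open>U\<close> must be allowed to contain them. The witness
    \<open>w\<close> keeps the expanded arguments from all being equal.\<close>
  have *: "M (replicate_mset n ?z + U) = 0"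
    if "set_mset U \<subseteq> D" "n + size U = d" "w \<in># U" "w \<noteq> x" "w \<noteq> y" "n > 0 \<or> (\<exists>v\<in>#U. v \<noteq> w)" for n U w
    using that
  proof (induction n arbitrary: U)
    case 0
    then obtain v where "v \<in># U" "v \<noteq> w"
      by blast
    thus ?case
      using diagonal_onD[OF D(1), of U v w] 0 by simp
  next
    case (Suc n)
    have "M (replicate_mset n ?z + add_mset v U) = 0" if "v = x \<or> v = y" for v
      using Suc.prems that D(2-) by (intro Suc.IH) auto
    from this[of x] this[of y] show ?case
      using Suc.prems by (simp add: sym_form_linear[OF M])
  qed
  have "diagonal_on d M (D - {x, y})"
    using D(1) by (rule diagonal_on_subset) simp
  thus ?thesis
  proof (rule diagonal_on_insert)
    fix j U assume j: "0 < j" "j < d" and U: "U \<in> multisets_of_size (D - {x, y}) (d - j)"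
    hence "U \<noteq> {#}"
      by (auto simp: multisets_of_size_def)
    then obtain w where "w \<in># U"
      by blast
    thus "M (replicate_mset j ?z + U) = 0"
      using *[of U j w] j U by (auto simp: multisets_of_size_def)
  qed
qed

text \<open>The copies of the combination are expanded one at a time. A term is dropped as soon as
  it contains both \<open>x\<close> and \<open>y\<close>, so no binomial coefficients
  appear.\<close>

lemma diagonal_value:
  assumes M: "sym_form d M" and D: "diagonal_on d M D" "x \<in> D" "y \<in> D" "x \<noteq> y" and d: "d > 0"
  shows "M (replicate_mset d (scale s x + scale t y))
     = s ^ d * M (replicate_mset d x) + t ^ d * M (replicate_mset d y)"
proof -
  define z where "z = scale s x + scale t y"
  have lin: "M (add_mset z U) = s * M (add_mset x U) + t * M (add_mset y U)" if "Suc (size U) = d" for U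
    unfolding z_def using M that by (rule sym_form_linear)
  have mixed: "M (replicate_mset n z + U) = 0"
    if "set_mset U \<subseteq> D" "n + size U = d" "x \<in># U" "y \<in># U" for n U
    using that
  proof (induction n arbitrary: U)
    case 0
    thus ?case
      using diagonal_onD[OF D(1), of U x y] D(4) by simp
  next
    case (Suc n)
    have "M (replicate_mset n z + add_mset v U) = 0" if "v = x \<or> v = y" for v
      using Suc.prems that D(2-) by (intro Suc.IH) auto
    from this[of x] this[of y] show ?case
      using Suc.prems by (simp add: lin)
  qed
  have left: "M (replicate_mset n z + replicate_mset (Suc m) x) = s ^ n * M (replicate_mset d x)"
    if "n + Suc m = d" for n m
    using that
  proof (induction n arbitrary: m)
    case (Suc n)
    have "M (replicate_mset n z + add_mset y (replicate_mset (Suc m) x)) = 0"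
      using Suc.prems D(2,3) by (intro mixed) auto
    thus ?case
      using lin[of "replicate_mset n z + replicate_mset (Suc m) x"] Suc.IH[of "Suc m"] Suc.prems
      by (simp add: add_mset_commute)
  qed auto
  have right: "M (replicate_mset n z + replicate_mset (Suc m) y) = t ^ n * M (replicate_mset d y)"
    if "n + Suc m = d" for n m
    using that
  proof (induction n arbitrary: m)
    case (Suc n)
    have "M (replicate_mset n z + add_mset x (replicate_mset (Suc m) y)) = 0"
      using Suc.prems D(2,3) by (intro mixed) auto
    thus ?case
      using lin[of "replicate_mset n z + replicate_mset (Suc m) y"] Suc.IH[of "Suc m"] Suc.prems
      by (simp add: add_mset_commute)
  qed auto
  obtain n where n: "d = Suc n"
    using d by (cases d) auto
  show ?thesis
    using left[of n 0] right[of n 0] lin[of "replicate_mset n z"] by (simp add: n flip: z_def)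
qed

subsection \<open>Systems of forms\<close>

definition sym_forms :: "nat \<Rightarrow> ('b multiset \<Rightarrow> 'a) set \<Rightarrow> bool" where
  "sym_forms d A \<longleftrightarrow> finite A \<and> (\<forall>M\<in>A. sym_form d M)"

definition common_zero :: "nat \<Rightarrow> ('b multiset \<Rightarrow> 'a) set \<Rightarrow> 'b \<Rightarrow> bool" where
  "common_zero d A x \<longleftrightarrow> (\<forall>M\<in>A. M (replicate_mset d x) = 0)"

text \<open>Partial polarizations: \<open>j\<close> arguments are filled with vectors from
  \<open>D\<close>, which leaves forms of lower degree in the vector still to be chosen.\<close>

definition lower :: "nat \<Rightarrow> 'b set \<Rightarrow> ('b multiset \<Rightarrow> 'a) set \<Rightarrow> ('b multiset \<Rightarrow> 'a) set" where
  "lower j D A = (\<lambda>(M, U) W. M (W + U)) ` (A \<times> multisets_of_size D j)"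

lemma sym_forms_lower: "sym_forms (d + j) A \<Longrightarrow> finite D \<Longrightarrow> sym_forms d (lower j D A)"
  using sym_form_lower[of _ d] by (auto simp: sym_forms_def lower_def multisets_of_size_def add.commute
      intro!: finite_imageI finite_multisets_of_size[unfolded multisets_of_size_def])

lemma card_lower:
  assumes "sym_forms d A" "finite D"
  shows "card (lower j D A) \<le> card A * ((card D + j - 1) choose j)"
proof -
  have "card (lower j D A) \<le> card (A \<times> multisets_of_size D j)"
    unfolding lower_def using assms
    by (intro card_image_le finite_cartesian_product finite_multisets_of_size) (auto simp: sym_forms_def)
  thus ?thesis
    using assms(2) by (simp add: card_cartesian_product card_multisets_of_size)
qed

lemma common_zero_lower:
  "common_zero d (lower j D A) x \<longleftrightarrow> (\<forall>M\<in>A. \<forall>U\<in>multisets_of_size D j. M (replicate_mset d x + U) = 0)"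
  by (auto simp: common_zero_def lower_def)

lemma sym_forms_Un: "sym_forms d (A \<union> B) \<longleftrightarrow> sym_forms d A \<and> sym_forms d B"
  by (auto simp: sym_forms_def)

lemma common_zero_Un: "common_zero d (A \<union> B) x \<longleftrightarrow> common_zero d A x \<and> common_zero d B x"
  by (auto simp: common_zero_def)

text \<open>
  \<open>n\<close> is the dimension of \<open>S\<close>, and \<open>N\<close> is the number of dimensions that are reserved for \<open>q\<close>
  quadratic and \<open>c\<close> cubic forms; the others may be spent on linear conditions.
\<close>

definition solvable :: "'b set \<Rightarrow> nat \<Rightarrow> nat \<Rightarrow> nat \<Rightarrow> nat \<Rightarrow> bool" where
  "solvable S n c q N \<longleftrightarrow> (\<forall>A\<^sub>1 A\<^sub>2 A\<^sub>3. sym_forms 1 A\<^sub>1 \<and> sym_forms 2 A\<^sub>2 \<and> sym_forms 3 A\<^sub>3 \<and>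
     card A\<^sub>1 + N \<le> n \<and> card A\<^sub>2 \<le> q \<and> card A\<^sub>3 \<le> c \<longrightarrow>
     (\<exists>x\<in>S. x \<noteq> 0 \<and> common_zero 1 A\<^sub>1 x \<and> common_zero 2 A\<^sub>2 x \<and> common_zero 3 A\<^sub>3 x))"

end

section \<open>From diagonal vectors of an anisotropic form to values and valuations\<close>

lemma (in diagonal_values) ex_realizes:
  assumes "R N"
  obtains W where "realizes W" "size W = size N"
proof -
  have "\<exists>W. rel_mset val_eq W N" if "0 \<notin># N" for N
    using that
  proof (induction N)
    case empty
    show ?case by (auto intro: exI[of _ "{#}"])
  next
    case (add a N)
    then obtain W where "rel_mset val_eq W N"
      by auto
    moreover obtain w where "val_eq w a"
      using add.prems by (auto elim: ex_val_eq)
    ultimately show ?case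
      by (blast intro: rel_mset_Plus)
  qed
  then obtain W where "rel_mset val_eq W N"
    using nonzero[OF assms] by blast
  thus ?thesis
    using that assms rel_mset_size unfolding realizes_def by blast
qed

text \<open>The situation to be refuted in degrees 2, 3 and 4 alike: one form \<open>M\<close> is
  singled out and has no non-trivial zero among the common zeros of the other forms.\<close>

locale anisotropic_system = form_space scale
  for scale :: "dyadic \<Rightarrow> 'v :: ab_group_add \<Rightarrow> 'v" +
  fixes S :: "'v set" and A\<^sub>1 A\<^sub>2 A\<^sub>3 :: "('v multiset \<Rightarrow> dyadic) set" and M :: "'v multiset \<Rightarrow> dyadic"
    and d :: nat
  assumes subspace: "subspace S"
    and forms: "sym_forms 1 A\<^sub>1" "sym_forms 2 A\<^sub>2" "sym_forms 3 A\<^sub>3" "sym_form d M"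
    and degree: "2 \<le> d" "d \<le> 4"
    and anisotropic: "\<And>x. x \<in> S \<Longrightarrow> common_zero 1 A\<^sub>1 x \<Longrightarrow> common_zero 2 A\<^sub>2 x \<Longrightarrow>
      common_zero 3 A\<^sub>3 x \<Longrightarrow> M (replicate_mset d x) = 0 \<Longrightarrow> x = 0"
begin

text \<open>The other forms have to vanish on the span of \<open>D\<close> and not just at its
  vectors, so that they also vanish at the vectors produced by merging.\<close>

definition good :: "'v set \<Rightarrow> bool" where
  "good D \<longleftrightarrow> finite D \<and> D \<subseteq> S - {0} \<and> diagonal_on d M D \<and>
     (\<forall>f\<in>A\<^sub>1. null_on 1 f D) \<and> (\<forall>f\<in>A\<^sub>2. null_on 2 f D) \<and> (\<forall>f\<in>A\<^sub>3. null_on 3 f D)"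

lemma good_subset: "good D \<Longrightarrow> D' \<subseteq> D \<Longrightarrow> good D'"
  unfolding good_def using finite_subset[of D' D] diagonal_on_subset[of d M D D']
    null_on_subset[of _ _ D D'] by blast

lemma good_empty: "good {}"
  using degree by (auto simp: good_def null_on_def diagonal_on_def)

lemma anisotropic_null:
  assumes "x \<in> S" "x \<noteq> 0" "x \<in> D"
    "\<forall>f\<in>A\<^sub>1. null_on 1 f D" "\<forall>f\<in>A\<^sub>2. null_on 2 f D" "\<forall>f\<in>A\<^sub>3. null_on 3 f D"
  shows "M (replicate_mset d x) \<noteq> 0"
proof -
  have "replicate_mset j x \<in> multisets_of_size D j" for j
    using assms(3) by (auto simp: multisets_of_size_def)
  hence "common_zero 1 A\<^sub>1 x" "common_zero 2 A\<^sub>2 x" "common_zero 3 A\<^sub>3 x"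
    using assms(4-6) unfolding common_zero_def null_on_def by blast+
  thus ?thesis
    using anisotropic assms(1,2) by blast
qed

lemma good_value_nonzero: "good D \<Longrightarrow> x \<in> D \<Longrightarrow> M (replicate_mset d x) \<noteq> 0"
  using anisotropic_null[of x D] by (auto simp: good_def)

text \<open>Pairing \<open>z\<close> with copies of \<open>x\<close> gives \<open>s\<close> times
  the value at \<open>x\<close>, so \<open>z\<close> is nonzero. Were \<open>z\<close> one of the
  remaining vectors, its own value would expand into mixed terms and vanish; thus the set really
  loses only one element.\<close>

lemma good_merge:
  fixes s t :: dyadic
  assumes D: "good D" "x \<in> D" "y \<in> D" "x \<noteq> y" and s: "s \<noteq> 0"
  defines "z \<equiv> scale s x + scale t y"
  shows "good (insert z (D - {x, y}))" "z \<notin> D - {x, y}"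
proof -
  obtain e where e: "d = Suc e" "e > 0"
    using degree by (cases d) auto
  have diag: "diagonal_on d M D"
    using D(1) by (simp add: good_def)
  have lin: "M (add_mset z U) = s * M (add_mset x U) + t * M (add_mset y U)" if "size U = e" for U
    unfolding z_def using forms(4) that e(1) by (intro sym_form_linear) simp_all
  have zS: "z \<in> S"
    unfolding z_def using subspace D by (intro subspace_add subspace_scale) (auto simp: good_def)
  have null: "\<forall>f\<in>A\<^sub>1. null_on 1 f (insert z D)" "\<forall>f\<in>A\<^sub>2. null_on 2 f (insert z D)"
      "\<forall>f\<in>A\<^sub>3. null_on 3 f (insert z D)"
    unfolding z_def using D forms(1-3) by (auto simp: good_def sym_forms_def intro!: null_on_combination)
  have z0: "z \<noteq> 0"
  proof
    assume "z = 0"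
    hence "M (add_mset z (replicate_mset e x)) = 0"
      using sym_form_zero[OF forms(4), of "replicate_mset e x"] e by simp
    moreover have "M (add_mset y (replicate_mset e x)) = 0"
      using D(2-4) e by (intro diagonal_onD[OF diag, of _ x y]) auto
    ultimately have "s * M (replicate_mset d x) = 0"
      using lin[of "replicate_mset e x"] e by simp
    thus False
      using s good_value_nonzero[OF D(1,2)] by simp
  qed
  show z: "z \<notin> D - {x, y}"
  proof
    assume z: "z \<in> D - {x, y}"
    have "M (add_mset v (replicate_mset e z)) = 0" if "v \<in> D" "v \<noteq> z" for v
      using that z e by (intro diagonal_onD[OF diag, of _ v z]) auto
    from this[of x] this[of y] have "M (add_mset z (replicate_mset e z)) = 0"
      using z D(2,3) lin[of "replicate_mset e z"] by auto
    thus False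
      using good_value_nonzero[OF D(1), of z] z e by simp
  qed
  have "insert z (D - {x, y}) \<subseteq> insert z D"
    by blast
  thus "good (insert z (D - {x, y}))"
    using D zS z0 null null_on_subset[of _ _ "insert z D" "insert z (D - {x, y})"]
      diagonal_on_combination[OF forms(4) diag D(2,3), of s t]
    by (auto simp: good_def z_def)
qed

text \<open>The factor \<open>t ^ d\<close> accounts for rescaling a vector, so that
  \<open>D\<close> itself need not change.\<close>

definition attained :: "dyadic multiset \<Rightarrow> bool" where
  "attained N \<longleftrightarrow> (\<exists>D. good D \<and>
     rel_mset (\<lambda>x a. \<exists>t. t \<noteq> 0 \<and> a = t ^ d * M (replicate_mset d x)) (mset_set D) N)"

lemma attainedE:
  assumes "attained (add_mset a N)"
  obtains x D t where "good (insert x D)" "x \<notin> D" "finite D" "t \<noteq> 0" "a = t ^ d * M (replicate_mset d x)"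
    "rel_mset (\<lambda>x a. \<exists>t. t \<noteq> 0 \<and> a = t ^ d * M (replicate_mset d x)) (mset_set D) N"
proof -
  obtain D where D: "good D"
    "rel_mset (\<lambda>x a. \<exists>t. t \<noteq> 0 \<and> a = t ^ d * M (replicate_mset d x)) (mset_set D) (add_mset a N)"
    using assms unfolding attained_def by blast
  from msed_rel_invR[OF D(2)] obtain x t U where x: "mset_set D = add_mset x U" "t \<noteq> 0"
      "a = t ^ d * M (replicate_mset d x)"
      "rel_mset (\<lambda>x a. \<exists>t. t \<noteq> 0 \<and> a = t ^ d * M (replicate_mset d x)) U N"
    by blast
  have fin: "finite D"
    using D(1) by (simp add: good_def)
  have "x \<in># mset_set D"
    by (simp add: x(1))
  hence xD: "x \<in> D"
    using fin by simp
  have "add_mset x (mset_set (D - {x})) = add_mset x U"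
    using fin xD mset_set.remove[of D x] x(1) by simp
  hence "U = mset_set (D - {x})"
    by simp
  moreover have "insert x (D - {x}) = D"
    using xD by blast
  ultimately show ?thesis
    using that[of x "D - {x}" t] x D(1) fin by simp
qed

lemma attainedI:
  assumes "good (insert x D)" "x \<notin> D" "finite D" "t \<noteq> 0" "a = t ^ d * M (replicate_mset d x)"
    "rel_mset (\<lambda>x a. \<exists>t. t \<noteq> 0 \<and> a = t ^ d * M (replicate_mset d x)) (mset_set D) N"
  shows "attained (add_mset a N)"
  unfolding attained_def
proof (intro exI conjI)
  show "rel_mset (\<lambda>x a. \<exists>t. t \<noteq> 0 \<and> a = t ^ d * M (replicate_mset d x)) (mset_set (insert x D)) (add_mset a N)"
    unfolding mset_set.insert[OF assms(3,2)]
    by (rule rel_mset_Plus) (use assms in auto)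
qed (rule assms(1))

lemma diagonal_values_attained:
  assumes "\<And>z :: dyadic_int. \<exists>t. 1 + 2 ^ e * z = t ^ d" "e > 0"
  shows "diagonal_values d e attained"
proof
  show "0 \<notin># N" if "attained N" for N
  proof
    assume "0 \<in># N"
    then obtain N' where "N = add_mset 0 N'"
      by (rule mset_add)
    with that have "attained (add_mset 0 N')"
      by simp
    then obtain x D t where "good (insert x D)" "t \<noteq> 0" "0 = t ^ d * M (replicate_mset d x)"
      by (rule attainedE)
    thus False
      using good_value_nonzero[of "insert x D" x] by simp
  qed
  show "attained N" if attained: "attained (add_mset a N)" for a N
    using attained
  proof (rule attainedE)
    fix x D t assume "good (insert x D)"
      "rel_mset (\<lambda>x a. \<exists>t. t \<noteq> 0 \<and> a = t ^ d * M (replicate_mset d x)) (mset_set D) N"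
    thus "attained N"
      unfolding attained_def using good_subset[of "insert x D" D] by blast
  qed
  show "attained (add_mset (t ^ d * a) N)" if attained: "attained (add_mset a N)" and t: "t \<noteq> 0" for a N t
    using attained
  proof (rule attainedE)
    fix x D s assume x: "good (insert x D)" "x \<notin> D" "finite D" "s \<noteq> 0" "a = s ^ d * M (replicate_mset d x)"
      "rel_mset (\<lambda>x a. \<exists>t. t \<noteq> 0 \<and> a = t ^ d * M (replicate_mset d x)) (mset_set D) N"
    show "attained (add_mset (t ^ d * a) N)"
      by (rule attainedI[OF x(1-3), of "t * s"]) (use x t in \<open>simp_all add: power_mult_distrib\<close>)
  qed
  show "attained (add_mset (a + b) N)" if attained: "attained (add_mset a (add_mset b N))" for a b N
    using attained
  proof (rule attainedE)
    fix x D s assume x: "good (insert x D)" "x \<notin> D" "finite D" "s \<noteq> 0" "a = s ^ d * M (replicate_mset d x)"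
      "rel_mset (\<lambda>x a. \<exists>t. t \<noteq> 0 \<and> a = t ^ d * M (replicate_mset d x)) (mset_set D) (add_mset b N)"
    from msed_rel_invR[OF x(6)] obtain y t U where y: "mset_set D = add_mset y U" "t \<noteq> 0"
        "b = t ^ d * M (replicate_mset d y)"
        "rel_mset (\<lambda>x a. \<exists>t. t \<noteq> 0 \<and> a = t ^ d * M (replicate_mset d x)) U N"
      by blast
    have "y \<in># mset_set D"
      by (simp add: y(1))
    hence yD: "y \<in> D"
      using x(3) by simp
    have "add_mset y (mset_set (D - {y})) = add_mset y U"
      using x(3) yD mset_set.remove[of D y] y(1) by simp
    hence U: "U = mset_set (D - {y})"
      by simp
    have xy: "x \<noteq> y" and rest: "insert x D - {x, y} = D - {y}"
      using x(2) yD by auto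
    \<comment> \<open>The pending factors are absorbed into the vector, so its value is
      \<open>a + b\<close> with factor 1.\<close>
    let ?z = "scale s x + scale t y"
    have "a + b = 1 ^ d * M (replicate_mset d ?z)"
      using diagonal_value[OF forms(4), of "insert x D" x y s t] x(1,5) y(3) xy yD degree
      by (simp add: good_def)
    thus ?thesis
      using good_merge[OF x(1) _ _ xy x(4), of t] y(4) U yD x(3)
      by (intro attainedI[of ?z "D - {y}" 1]) (simp_all add: rest)
  qed
qed (use assms in auto)

text \<open>All conditions on the new vector are sorted by their degree in it:
  \<open>B\<^sub>1\<close>, \<open>B\<^sub>2\<close>, \<open>B\<^sub>3\<close> collect the given
  forms, their partial polarizations and the mixed coefficients of \<open>M\<close>. The binomial
  coefficients count multisets of old vectors. The value of \<open>M\<close> at the new vector stays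
  unrestricted.\<close>

lemma good_extend:
  assumes D: "good D" and sol: "solvable S n c q N"
    and bounds: "card A\<^sub>1 + card A\<^sub>2 * card D + card A\<^sub>3 * (Suc (card D) choose 2)
        + ((card D + (d - 1) - 1) choose (d - 1)) + N \<le> n"
      "card A\<^sub>2 + card A\<^sub>3 * card D + (if d \<ge> 3 then (card D + (d - 2) - 1) choose (d - 2) else 0) \<le> q"
      "card A\<^sub>3 + (if d \<ge> 4 then (card D + (d - 3) - 1) choose (d - 3) else 0) \<le> c"
  obtains x where "x \<notin> D" "good (insert x D)"
proof -
  have fin: "finite D"
    using D by (simp add: good_def)
  have M: "sym_forms d {M}"
    using forms(4) by (simp add: sym_forms_def)
  define B\<^sub>1 where "B\<^sub>1 = A\<^sub>1 \<union> lower 1 D A\<^sub>2 \<union> lower 2 D A\<^sub>3 \<union> lower (d - 1) D {M}"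
  define B\<^sub>2 where "B\<^sub>2 = A\<^sub>2 \<union> lower 1 D A\<^sub>3 \<union> (if d \<ge> 3 then lower (d - 2) D {M} else {})"
  define B\<^sub>3 where "B\<^sub>3 = A\<^sub>3 \<union> (if d \<ge> 4 then lower (d - 3) D {M} else {})"
  have low: "sym_forms (d - j) (lower j D {M})" if "j < d" for j
    using sym_forms_lower[of "d - j" j "{M}" D] M fin that by simp
  have B: "sym_forms 1 B\<^sub>1" "sym_forms 2 B\<^sub>2" "sym_forms 3 B\<^sub>3"
    unfolding B\<^sub>1_def B\<^sub>2_def B\<^sub>3_def sym_forms_Un
    using forms(1-3) fin degree sym_forms_lower[of 1 1 A\<^sub>2 D] sym_forms_lower[of 1 2 A\<^sub>3 D]
      sym_forms_lower[of 2 1 A\<^sub>3 D] low[of "d - 1"] low[of "d - 2"] low[of "d - 3"]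
    by (auto simp: numeral_2_eq_2 numeral_3_eq_3 sym_forms_def[of _ "{}"])
  have lowM: "card (lower j D {M}) \<le> (card D + j - 1) choose j" for j
    using card_lower[OF M fin, of j] by simp
  have "card B\<^sub>1 \<le> card A\<^sub>1 + card (lower 1 D A\<^sub>2) + card (lower 2 D A\<^sub>3) + card (lower (d - 1) D {M})"
    unfolding B\<^sub>1_def by (meson add_le_mono1 card_Un_le le_trans)
  also have "\<dots> \<le> card A\<^sub>1 + card A\<^sub>2 * card D + card A\<^sub>3 * (Suc (card D) choose 2)
        + ((card D + (d - 1) - 1) choose (d - 1))"
    using card_lower[OF forms(2) fin, of 1] card_lower[OF forms(3) fin, of 2] lowM[of "d - 1"] by simp
  finally have B1: "card B\<^sub>1 + N \<le> n"
    using bounds(1) by linarith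
  have "card B\<^sub>2 \<le> card A\<^sub>2 + card (lower 1 D A\<^sub>3) + card (if d \<ge> 3 then lower (d - 2) D {M} else {})"
    unfolding B\<^sub>2_def by (meson add_le_mono1 card_Un_le le_trans)
  also have "\<dots> \<le> q"
    using card_lower[OF forms(3) fin, of 1] lowM[of "d - 2"] bounds(2) by (auto split: if_splits)
  finally have B2: "card B\<^sub>2 \<le> q" .
  have "card B\<^sub>3 \<le> card A\<^sub>3 + card (if d \<ge> 4 then lower (d - 3) D {M} else {})"
    unfolding B\<^sub>3_def by (rule card_Un_le)
  also have "\<dots> \<le> c"
    using lowM[of "d - 3"] bounds(3) by (auto split: if_splits)
  finally have B3: "card B\<^sub>3 \<le> c" .
  obtain x where x: "x \<in> S" "x \<noteq> 0" "common_zero 1 B\<^sub>1 x" "common_zero 2 B\<^sub>2 x" "common_zero 3 B\<^sub>3 x"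
    using sol B B1 B2 B3 unfolding solvable_def by blast
  have cases: "j = 1 \<or> j = 2 \<or> j = 3" if "0 < j" "j < 4" for j :: nat
    using that by linarith
  have own: "M (replicate_mset j x + U) = 0"
    if "0 < j" "j < d" "U \<in> multisets_of_size D (d - j)" for j U
    using x(3-5) that degree cases[of j]
    by (auto simp: B\<^sub>1_def B\<^sub>2_def B\<^sub>3_def common_zero_Un common_zero_lower)
  have diag: "diagonal_on d M (insert x D)"
    using D own by (intro diagonal_on_insert) (auto simp: good_def)
  have null1: "null_on 1 f (insert x D)" if "f \<in> A\<^sub>1" for f
  proof (rule null_on_insert)
    fix j U assume "0 < j" "j \<le> 1" "U \<in> multisets_of_size D (1 - j)"
    thus "f (replicate_mset j x + U) = 0"
      using x(3) that by (cases "j = 1") (auto simp: B\<^sub>1_def common_zero_Un common_zero_def)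
  qed (use D that in \<open>simp add: good_def\<close>)
  have null2: "null_on 2 f (insert x D)" if "f \<in> A\<^sub>2" for f
  proof (rule null_on_insert)
    fix j U assume j: "0 < j" "j \<le> 2" and U: "U \<in> multisets_of_size D (2 - j)"
    have "j = 1 \<or> j = 2"
      using j by linarith
    thus "f (replicate_mset j x + U) = 0"
      using x(3,4) that U
      by (auto simp: B\<^sub>1_def B\<^sub>2_def common_zero_Un common_zero_lower common_zero_def[of _ "A\<^sub>2"])
  qed (use D that in \<open>simp add: good_def\<close>)
  have null3: "null_on 3 f (insert x D)" if "f \<in> A\<^sub>3" for f
  proof (rule null_on_insert)
    fix j U assume j: "0 < j" "j \<le> 3" and U: "U \<in> multisets_of_size D (3 - j)"
    have "j = 1 \<or> j = 2 \<or> j = 3"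
      using j by linarith
    thus "f (replicate_mset j x + U) = 0"
      using x(3-5) that U
      by (auto simp: B\<^sub>1_def B\<^sub>2_def B\<^sub>3_def common_zero_Un common_zero_lower common_zero_def[of _ "A\<^sub>3"])
  qed (use D that in \<open>simp add: good_def\<close>)
  \<comment> \<open>An old vector would satisfy the mixed condition with itself as the old argument,
    and so would be a zero of \<open>M\<close>.\<close>
  have "x \<notin> D"
  proof
    assume xD: "x \<in> D"
    hence "{#x#} \<in> multisets_of_size D (d - (d - 1))"
      using degree by (simp add: multisets_of_size_def)
    hence "M (replicate_mset (d - 1) x + {#x#}) = 0"
      using degree by (intro own) auto
    moreover have "replicate_mset (d - 1) x + {#x#} = replicate_mset d x"
      using degree by (cases d) auto
    ultimately show False
      using good_value_nonzero[OF D xD] by simp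
  qed
  moreover have "good (insert x D)"
    using D fin x(1,2) diag null1 null2 null3 by (simp add: good_def)
  ultimately show ?thesis
    by (rule that)
qed

lemma attained_extend:
  assumes "attained N\<^sub>0" and ext: "\<And>D. good D \<Longrightarrow> card D = size N\<^sub>0 \<Longrightarrow> \<exists>x. x \<notin> D \<and> good (insert x D)"
  shows "\<exists>a. attained (add_mset a N\<^sub>0)"
proof -
  obtain D where D: "good D"
    "rel_mset (\<lambda>x a. \<exists>t. t \<noteq> 0 \<and> a = t ^ d * M (replicate_mset d x)) (mset_set D) N\<^sub>0"
    using assms(1) unfolding attained_def by blast
  moreover from D obtain x where "x \<notin> D" "good (insert x D)"
    using ext[of D] rel_mset_size[OF D(2)] by (auto simp: good_def)
  ultimately show ?thesis
    using attainedI[of x D 1] by (auto simp: good_def)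
qed

lemma attained_empty: "attained {#}"
  unfolding attained_def using good_empty by (auto intro!: exI[of _ "{}"])

lemma attained_of_size:
  assumes ext: "\<And>D. good D \<Longrightarrow> card D < k \<Longrightarrow> \<exists>x. x \<notin> D \<and> good (insert x D)"
  obtains N where "attained N" "size N = k"
proof -
  have "\<exists>N. attained N \<and> size N = j" if "j \<le> k" for j
    using that
  proof (induction j)
    case 0
    thus ?case
      using attained_empty by auto
  next
    case (Suc j)
    then obtain N where N: "attained N" "size N = j"
      by auto
    have "\<exists>a. attained (add_mset a N)"
      by (rule attained_extend[OF N(1) ext]) (use N(2) Suc.prems in simp_all)
    then obtain a where "attained (add_mset a N)"
      by blast
    thus ?case
      using N(2) by (intro exI[of _ "add_mset a N"]) simp
  qed
  thus ?thesis
    using that by blast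
qed

end

section \<open>Dimensions needed for systems of quadratic and cubic forms\<close>

locale dyadic_form_space = form_space scale
  for scale :: "dyadic \<Rightarrow> 'v :: ab_group_add \<Rightarrow> 'v" +
  fixes S :: "'v set" and n :: nat
  assumes subspace: "subspace S"
    and linear_solvable: "solvable S n 0 0 1"
begin

text \<open>Five diagonal vectors for one of the forms are needed. When the last is chosen there are
  four old ones, and each of the \<open>Suc q\<close> forms imposes a linear condition per old
  vector, hence \<open>4 * Suc q\<close>.\<close>

lemma solvable_quadratic_step:
  assumes sol: "solvable S n 0 q N"
  shows "solvable S n 0 (Suc q) (N + 4 * Suc q)"
  unfolding solvable_def
proof (intro allI impI, elim conjE)
  fix A\<^sub>1 A\<^sub>2 A\<^sub>3 :: "('v multiset \<Rightarrow> dyadic) set"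
  assume forms: "sym_forms 1 A\<^sub>1" "sym_forms 2 A\<^sub>2" "sym_forms 3 A\<^sub>3"
    and card: "card A\<^sub>1 + (N + 4 * Suc q) \<le> n" "card A\<^sub>2 \<le> Suc q" "card A\<^sub>3 \<le> 0"
  show "\<exists>x\<in>S. x \<noteq> 0 \<and> common_zero 1 A\<^sub>1 x \<and> common_zero 2 A\<^sub>2 x \<and> common_zero 3 A\<^sub>3 x"
  proof (cases "A\<^sub>2 = {}")
    case True
    have "card A\<^sub>1 + N \<le> n" "card A\<^sub>2 \<le> q"
      using card True by simp_all
    thus ?thesis
      using sol forms card(3) unfolding solvable_def by blast
  next
    case False
    then obtain M where M: "M \<in> A\<^sub>2"
      by blast
    have A2: "sym_forms 2 (A\<^sub>2 - {M})" "sym_form 2 M"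
      using forms(2) M by (auto simp: sym_forms_def)
    have card2: "card (A\<^sub>2 - {M}) \<le> q"
      using card(2) M forms(2) by (simp add: sym_forms_def)
    show ?thesis
    proof (rule ccontr)
      assume no_zero: "\<not> ?thesis"
      have aniso: "x = 0" if "x \<in> S" "common_zero 1 A\<^sub>1 x" "common_zero 2 (A\<^sub>2 - {M}) x" "common_zero 3 A\<^sub>3 x"
          "M (replicate_mset 2 x) = 0" for x
        using no_zero that by (auto simp: common_zero_def)
      interpret anisotropic_system scale S A\<^sub>1 "A\<^sub>2 - {M}" A\<^sub>3 M 2
        by unfold_locales (use subspace forms A2 aniso in auto)
      interpret square_values attained
        unfolding square_values_def
        by (rule diagonal_values_attained) (use dyadic_int_square in auto)
      have "\<exists>x. x \<notin> D \<and> good (insert x D)" if D: "good D" "card D < 5" for D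
      proof -
        have "card (A\<^sub>2 - {M}) * card D \<le> q * 4"
          using card2 D(2) by (intro mult_le_mono) simp_all
        hence "card A\<^sub>1 + card (A\<^sub>2 - {M}) * card D + card D + N \<le> n"
          using card(1) D(2) unfolding mult_Suc_right by linarith
        thus ?thesis
          using good_extend[OF D(1) sol] card2 card(3) by auto
      qed
      then obtain N where N: "attained N" "size N = 5"
        by (rule attained_of_size)
      obtain W where "realizes W" "size W = size N"
        using N(1) by (rule ex_realizes)
      thus False
        using realizes_size_less_5[of W] N(2) by simp
    qed
  qed
qed

text \<open>The bound is 1 + 4(1 + ... + q); the 1 leaves room for a nonzero solution of the linear
  conditions.\<close>

lemma solvable_quadratic: "solvable S n 0 q (2 * q\<^sup>2 + 2 * q + 1)"
proof (induction q)
  case 0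
  thus ?case
    using linear_solvable by simp
next
  case (Suc q)
  have "2 * q\<^sup>2 + 2 * q + 1 + 4 * Suc q = 2 * (Suc q)\<^sup>2 + 2 * Suc q + 1"
    by (simp add: power2_eq_square)
  thus ?case
    using solvable_quadratic_step[OF Suc] by (simp only:)
qed

text \<open>Four diagonal vectors are needed, so at most three old ones occur. Each of the
  \<open>Suc c\<close> cubic forms then imposes 3 quadratic and 6 linear conditions, and each of the
  \<open>q\<close> quadratic forms 3 linear ones.\<close>

lemma solvable_cubic_step:
  assumes sol: "solvable S n c (q + 3 * Suc c) N"
  shows "solvable S n (Suc c) q (N + 3 * q + 6 * Suc c)"
  unfolding solvable_def
proof (intro allI impI, elim conjE)
  fix A\<^sub>1 A\<^sub>2 A\<^sub>3 :: "('v multiset \<Rightarrow> dyadic) set"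
  assume forms: "sym_forms 1 A\<^sub>1" "sym_forms 2 A\<^sub>2" "sym_forms 3 A\<^sub>3"
    and card: "card A\<^sub>1 + (N + 3 * q + 6 * Suc c) \<le> n" "card A\<^sub>2 \<le> q" "card A\<^sub>3 \<le> Suc c"
  show "\<exists>x\<in>S. x \<noteq> 0 \<and> common_zero 1 A\<^sub>1 x \<and> common_zero 2 A\<^sub>2 x \<and> common_zero 3 A\<^sub>3 x"
  proof (cases "A\<^sub>3 = {}")
    case True
    have "card A\<^sub>1 + N \<le> n" "card A\<^sub>2 \<le> q + 3 * Suc c" "card A\<^sub>3 \<le> c"
      using card True by simp_all
    thus ?thesis
      using sol forms unfolding solvable_def by blast
  next
    case False
    then obtain M where M: "M \<in> A\<^sub>3"
      by blast
    have A3: "sym_forms 3 (A\<^sub>3 - {M})" "sym_form 3 M"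
      using forms(3) M by (auto simp: sym_forms_def)
    have card3: "card (A\<^sub>3 - {M}) \<le> c"
      using card(3) M forms(3) by (simp add: sym_forms_def)
    show ?thesis
    proof (rule ccontr)
      assume no_zero: "\<not> ?thesis"
      have aniso: "x = 0" if "x \<in> S" "common_zero 1 A\<^sub>1 x" "common_zero 2 A\<^sub>2 x" "common_zero 3 (A\<^sub>3 - {M}) x"
          "M (replicate_mset 3 x) = 0" for x
        using no_zero that by (auto simp: common_zero_def)
      interpret anisotropic_system scale S A\<^sub>1 A\<^sub>2 "A\<^sub>3 - {M}" M 3
        by unfold_locales (use subspace forms A3 aniso in auto)
      interpret cube_values attained
        unfolding cube_values_def
        by (rule diagonal_values_attained) (use dyadic_int_cube in auto)
      have "\<exists>x. x \<notin> D \<and> good (insert x D)" if D: "good D" "card D < 4" for D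
      proof -
        have pairs: "Suc (card D) choose 2 \<le> 6"
          using binomial_right_mono[of "Suc (card D)" 4 2] D(2) by (simp add: numeral_eq_Suc)
        have "card A\<^sub>2 * card D \<le> q * 3" "card (A\<^sub>3 - {M}) * (Suc (card D) choose 2) \<le> c * 6"
            "card (A\<^sub>3 - {M}) * card D \<le> c * 3"
          using card(2) card3 D(2) pairs by (intro mult_le_mono; simp)+
        hence "card A\<^sub>1 + card A\<^sub>2 * card D + card (A\<^sub>3 - {M}) * (Suc (card D) choose 2)
            + (Suc (card D) choose 2) + N \<le> n"
          "card A\<^sub>2 + card (A\<^sub>3 - {M}) * card D + card D \<le> q + 3 * Suc c"
          using card(1,2) D(2) pairs unfolding mult_Suc_right by linarith+
        thus ?thesis
          using good_extend[OF D(1) sol] card3 by auto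
      qed
      then obtain N where N: "attained N" "size N = 4"
        by (rule attained_of_size)
      obtain W where "realizes W" "size W = size N"
        using N(1) by (rule ex_realizes)
      thus False
        using realizes_size_less_4[of W] N(2) by simp
    qed
  qed
qed

text \<open>Five old vectors lead to 5 cubic, 15 quadratic and 35 linear forms. Removing the cubic
  forms one by one turns 15 quadratic forms into 15 + 3(5 + 4 + 3 + 2 + 1) = 60, where the recursion
  starts; it ends at 7996, and 7996 + 35 = 8031.\<close>

lemma quartic_zero:
  assumes M: "sym_form 4 M" and n: "n \<ge> 8031"
  obtains x where "x \<in> S" "x \<noteq> 0" "M (replicate_mset 4 x) = 0"
proof (rule ccontr)
  note that' = that
  assume contr: "\<not> thesis"
  have aniso: "x = 0" if "x \<in> S" "M (replicate_mset 4 x) = 0" for x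
    using contr that that' by blast
  interpret anisotropic_system scale S "{}" "{}" "{}" M 4
    by unfold_locales (use subspace M aniso in \<open>auto simp: sym_forms_def\<close>)
  have "solvable S n 0 60 7321"
    using solvable_quadratic[of 60] by simp
  hence "solvable S n 1 57 7498"
    using solvable_cubic_step[of 0 57 7321] by simp
  hence "solvable S n 2 51 7663"
    using solvable_cubic_step[of 1 51 7498] by (simp add: numeral_2_eq_2)
  hence "solvable S n 3 42 7807"
    using solvable_cubic_step[of 2 42 7663] by simp
  hence "solvable S n 4 30 7921"
    using solvable_cubic_step[of 3 30 7807] by simp
  hence sol: "solvable S n 5 15 7996"
    using solvable_cubic_step[of 4 15 7921] by simp
  have ext: "\<exists>x. x \<notin> D \<and> good (insert x D)" if D: "good D" "card D < 6" for D
  proof -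
    have "(card D + 2) choose 3 \<le> 7 choose 3" "Suc (card D) choose 2 \<le> 6 choose 2"
      using D(2) by (intro binomial_right_mono; simp)+
    moreover have "(7 :: nat) choose 3 = 35" "(6 :: nat) choose 2 = 15"
      by (simp_all add: eval_nat_numeral)
    ultimately show ?thesis
      using good_extend[OF D(1) sol] D(2) n by auto
  qed
  interpret diagonal_values 4 4 attained
    by (rule diagonal_values_attained) (use dyadic_int_fourth_power in auto)
  interpret quartic_values attained
  proof
    show "\<exists>a. attained (add_mset a N)" if "attained N" "size N < 6" for N
      using that by (intro attained_extend ext) simp_all
  qed (rule attained_empty)
  show False
    by (rule contradiction)
qed

end

section \<open>Polarization\<close>

text \<open>Gaussian elimination: a pivot removes one equation together with one unknown, whose
  value is restored afterwards from the removed equation.\<close>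

lemma homogeneous_system_nontrivial:
  fixes a :: "'i \<Rightarrow> 'j \<Rightarrow> 'k :: field"
  assumes "finite I" "finite J" "card I < card J"
  shows "\<exists>x. (\<exists>j\<in>J. x j \<noteq> 0) \<and> (\<forall>i\<in>I. (\<Sum>j\<in>J. a i j * x j) = 0)"
  using assms
proof (induction I arbitrary: J a rule: finite_induct)
  case empty
  hence "J \<noteq> {}"
    by auto
  thus ?case
    by (intro exI[of _ "\<lambda>_. 1"]) auto
next
  case (insert r I)
  show ?case
  proof (cases "\<forall>j\<in>J. a r j = 0")
    case True
    have "card I < card J"
      using insert by simp
    then obtain x where "\<exists>j\<in>J. x j \<noteq> 0" "\<forall>i\<in>I. (\<Sum>j\<in>J. a i j * x j) = 0"
      using insert.IH insert.prems(1) by blast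
    thus ?thesis
      using True by (intro exI[of _ x]) simp
  next
    case False
    then obtain p where p: "p \<in> J" "a r p \<noteq> 0"
      by blast
    define J' where "J' = J - {p}"
    have J: "finite J'" "p \<notin> J'" "J = insert p J'"
      using insert.prems(1) p(1) by (auto simp: J'_def)
    have "card I < card J'"
      using insert.prems(2) insert.hyps J by simp
    from insert.IH[OF J(1) this, of "\<lambda>i j. a i j - a i p / a r p * a r j"]
    obtain x where x: "\<exists>j\<in>J'. x j \<noteq> 0"
      "\<forall>i\<in>I. (\<Sum>j\<in>J'. (a i j - a i p / a r p * a r j) * x j) = 0"
      by blast
    define y where "y = x(p := - (\<Sum>j\<in>J'. a r j * x j) / a r p)"
    have y_p: "y p = - (\<Sum>j\<in>J'. a r j * x j) / a r p"
      by (simp add: y_def)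
    have sum_y: "(\<Sum>j\<in>J. a i j * y j) = a i p * y p + (\<Sum>j\<in>J'. a i j * x j)" for i
    proof -
      have "(\<Sum>j\<in>J'. a i j * y j) = (\<Sum>j\<in>J'. a i j * x j)"
        using J(2) by (intro sum.cong) (auto simp: y_def)
      thus ?thesis
        using J by simp
    qed
    have "(\<Sum>j\<in>J. a i j * y j) = 0" if "i \<in> I" for i
    proof -
      have "(\<Sum>j\<in>J'. a i j * x j) = a i p / a r p * (\<Sum>j\<in>J'. a r j * x j)"
        using x(2) that by (simp add: sum_subtractf sum_distrib_left left_diff_distrib mult.assoc)
      thus ?thesis
        by (simp add: sum_y y_p)
    qed
    moreover have "(\<Sum>j\<in>J. a r j * y j) = 0"
      using p(2) by (simp add: sum_y y_p)
    moreover have "\<exists>j\<in>J. y j \<noteq> 0"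
      using x(1) J by (auto simp: y_def)
    ultimately show ?thesis
      by blast
  qed
qed

text \<open>For as many vectors as indices this is the permanent of their coordinate matrix,
  expanded along its rows: up to the factor d!, the polarization of the monomial given by the
  list.\<close>

fun symmetric_product :: "'i list \<Rightarrow> ('i \<Rightarrow> 'a :: comm_semiring_1) multiset \<Rightarrow> 'a" where
  "symmetric_product [] U = 1"
| "symmetric_product (i # is) U = (\<Sum>v\<in>#U. v i * symmetric_product is (U - {#v#}))"

lemma symmetric_product_Cons_add_mset:
  "symmetric_product (i # is) (add_mset x U) =
     x i * symmetric_product is U + (\<Sum>v\<in>#U. v i * symmetric_product is (add_mset x (U - {#v#})))"
proof -
  have "(\<Sum>v\<in>#U. v i * symmetric_product is (add_mset x U - {#v#})) =
      (\<Sum>v\<in>#U. v i * symmetric_product is (add_mset x (U - {#v#})))"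
    by (intro arg_cong[of _ _ sum_mset] image_mset_cong) (simp add: add_mset_remove_trivial_If diff_union_swap2)
  thus ?thesis
    by simp
qed

lemma symmetric_product_add:
  "Suc (size U) = length is \<Longrightarrow> symmetric_product is (add_mset (\<lambda>i. x i + y i) U) =
     symmetric_product is (add_mset x U) + symmetric_product is (add_mset y U)"
proof (induction "is" arbitrary: U)
  case (Cons i "is")
  have "symmetric_product is (add_mset (\<lambda>i. x i + y i) (U - {#v#})) =
      symmetric_product is (add_mset x (U - {#v#})) + symmetric_product is (add_mset y (U - {#v#}))"
    if "v \<in># U" for v
    using that Cons.prems size_Suc_Diff1[OF that] by (intro Cons.IH) simp
  hence "(\<Sum>v\<in>#U. v i * symmetric_product is (add_mset (\<lambda>i. x i + y i) (U - {#v#}))) =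
      (\<Sum>v\<in>#U. v i * symmetric_product is (add_mset x (U - {#v#})) +
        v i * symmetric_product is (add_mset y (U - {#v#})))"
    by (intro arg_cong[of _ _ sum_mset] image_mset_cong) (simp add: distrib_left)
  thus ?case
    unfolding symmetric_product_Cons_add_mset by (simp add: sum_mset.distrib algebra_simps)
qed simp

lemma symmetric_product_scale:
  "Suc (size U) = length is \<Longrightarrow> symmetric_product is (add_mset (\<lambda>i. c * x i) U) =
     c * symmetric_product is (add_mset x U)"
proof (induction "is" arbitrary: U)
  case (Cons i "is")
  have "symmetric_product is (add_mset (\<lambda>i. c * x i) (U - {#v#})) =
      c * symmetric_product is (add_mset x (U - {#v#}))"
    if "v \<in># U" for v
    using that Cons.prems size_Suc_Diff1[OF that] by (intro Cons.IH) simp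
  hence "(\<Sum>v\<in>#U. v i * symmetric_product is (add_mset (\<lambda>i. c * x i) (U - {#v#}))) =
      (\<Sum>v\<in>#U. c * (v i * symmetric_product is (add_mset x (U - {#v#}))))"
    by (intro arg_cong[of _ _ sum_mset] image_mset_cong) (simp add: ac_simps)
  thus ?case
    unfolding symmetric_product_Cons_add_mset
    by (simp add: sum_mset_distrib_left[symmetric] algebra_simps)
qed simp

lemma symmetric_product_replicate:
  "symmetric_product is (replicate_mset (length is) x) = of_nat (fact (length is)) * prod_list (map x is)"
proof (induction "is")
  case (Cons i "is")
  have "replicate_mset (Suc (length is)) x - {#x#} = replicate_mset (length is) x"
    by simp
  thus ?case
    using Cons.IH by (simp add: sum_mset_replicate_mset algebra_simps del: replicate_mset_Suc)
qed simp

lemma monomial_as_list: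
  obtains l where "length l = (\<Sum>i\<in>Poly_Mapping.keys m. Poly_Mapping.lookup m i)"
    "\<And>x :: nat \<Rightarrow> 'a :: comm_semiring_1.
       prod_list (map x l) = (\<Prod>i\<in>Poly_Mapping.keys m. x i ^ Poly_Mapping.lookup m i)"
proof -
  have "\<exists>l. length l = (\<Sum>i\<in>A. Poly_Mapping.lookup m i) \<and>
      (\<forall>x :: nat \<Rightarrow> 'a. prod_list (map x l) = (\<Prod>i\<in>A. x i ^ Poly_Mapping.lookup m i))" if "finite A" for A
    using that
  proof (induction A rule: finite_induct)
    case (insert i A)
    then obtain l where "length l = (\<Sum>i\<in>A. Poly_Mapping.lookup m i)"
      "\<forall>x :: nat \<Rightarrow> 'a. prod_list (map x l) = (\<Prod>i\<in>A. x i ^ Poly_Mapping.lookup m i)"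
      by blast
    thus ?case
      using insert.hyps by (intro exI[of _ "replicate (Poly_Mapping.lookup m i) i @ l"]) simp
  qed simp
  from this[of "Poly_Mapping.keys m"] show ?thesis
    using that by auto
qed

interpretation fun_space: form_space "\<lambda>(c :: 'a :: field) x i :: nat. c * x i"
  by unfold_locales (auto simp: fun_eq_iff algebra_simps)

text \<open>The form is polarized monomial by monomial, with division by d!. Over the dyadic numbers
  4! is not a unit of the integers, which is harmless because integrality of \<open>M\<close> plays
  no part.\<close>

lemma ex_symmetric_form:
  fixes F :: "'a :: field mpoly"
  assumes F: "is_form d n F" and d: "(of_nat (fact d) :: 'a) \<noteq> 0"
  obtains M where "fun_space.sym_form d M" "\<And>x. M (replicate_mset d x) = mpoly_eval F x"
proof -
  have "\<exists>l. length l = d \<and> (\<forall>x :: nat \<Rightarrow> 'a.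
      prod_list (map x l) = (\<Prod>i\<in>Poly_Mapping.keys m. x i ^ Poly_Mapping.lookup m i))"
    if "m \<in> Poly_Mapping.keys F" for m
    using that F monomial_as_list[of m] unfolding is_form_def by metis
  then obtain l where l: "\<And>m. m \<in> Poly_Mapping.keys F \<Longrightarrow> length (l m) = d"
    "\<And>m x. m \<in> Poly_Mapping.keys F \<Longrightarrow>
      prod_list (map (x :: nat \<Rightarrow> 'a) (l m)) = (\<Prod>i\<in>Poly_Mapping.keys m. x i ^ Poly_Mapping.lookup m i)"
    by metis
  define M where
    "M U = (\<Sum>m\<in>Poly_Mapping.keys F. Poly_Mapping.lookup F m / of_nat (fact d) * symmetric_product (l m) U)" for U
  have "fun_space.sym_form d M"
    unfolding fun_space.sym_form_def
  proof (intro allI impI conjI)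
    fix U :: "(nat \<Rightarrow> 'a) multiset" and x y :: "nat \<Rightarrow> 'a" and c
    assume U: "Suc (size U) = d"
    have "symmetric_product (l m) (add_mset (x + y) U) =
        symmetric_product (l m) (add_mset x U) + symmetric_product (l m) (add_mset y U)"
      if "m \<in> Poly_Mapping.keys F" for m
      unfolding plus_fun_def using U l(1)[OF that] by (intro symmetric_product_add) simp
    thus "M (add_mset (x + y) U) = M (add_mset x U) + M (add_mset y U)"
      by (simp add: M_def distrib_left sum.distrib)
    have "symmetric_product (l m) (add_mset (\<lambda>i. c * x i) U) = c * symmetric_product (l m) (add_mset x U)"
      if "m \<in> Poly_Mapping.keys F" for m
      using U l(1)[OF that] by (intro symmetric_product_scale) simp
    thus "M (add_mset (\<lambda>i. c * x i) U) = c * M (add_mset x U)"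
      by (simp add: M_def sum_distrib_left mult.left_commute)
  qed
  moreover have "M (replicate_mset d x) = mpoly_eval F x" for x
    unfolding M_def mpoly_eval_def
  proof (rule sum.cong)
    fix m assume m: "m \<in> Poly_Mapping.keys F"
    show "Poly_Mapping.lookup F m / of_nat (fact d) * symmetric_product (l m) (replicate_mset d x) =
        Poly_Mapping.lookup F m * (\<Prod>i\<in>Poly_Mapping.keys m. x i ^ Poly_Mapping.lookup m i)"
      using symmetric_product_replicate[of "l m" x] l[OF m] d by (simp del: of_nat_fact)
  qed simp
  ultimately show ?thesis
    by (rule that)
qed

text \<open>Cutting off the coordinates from \<open>n\<close> on turns "nonzero as a function" into
  "nonzero in one of the first \<open>n\<close> coordinates".\<close>

definition supported_below :: "nat \<Rightarrow> (nat \<Rightarrow> 'a :: zero) set" where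
  "supported_below n = {x. \<forall>i\<ge>n. x i = 0}"

lemma linear_form_expansion:
  fixes M :: "(nat \<Rightarrow> 'a :: field) multiset \<Rightarrow> 'a"
  assumes "fun_space.sym_form 1 M"
  shows "M {#\<lambda>i. if i < n then x i else 0#} = (\<Sum>j<n. M {#\<lambda>i. if i = j then 1 else 0#} * x j)"
proof (induction n)
  case 0
  show ?case
    using fun_space.sym_form_zero[OF assms, of "{#}"] by (simp add: zero_fun_def)
next
  case (Suc n)
  have "M {#(\<lambda>i. 1 * (if i < n then x i else 0)) + (\<lambda>i. x n * (if i = n then 1 else 0))#} =
      1 * M {#\<lambda>i. if i < n then x i else 0#} + x n * M {#\<lambda>i. if i = n then 1 else 0#}"
    by (rule fun_space.sym_form_linear[OF assms]) simp
  moreover have "(\<lambda>i. 1 * (if i < n then x i else 0)) + (\<lambda>i. x n * (if i = n then 1 else 0)) =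
      (\<lambda>i. if i < Suc n then x i else 0)"
    by (auto simp: fun_eq_iff less_Suc_eq)
  ultimately show ?case
    using Suc.IH by simp
qed

text \<open>The base of the recursion is linear algebra: the one reserved dimension is the excess of
  unknowns over equations.\<close>

interpretation dyadic_form_space "\<lambda>(c :: dyadic) x i :: nat. c * x i" "supported_below n" n for n
proof unfold_locales
  show "fun_space.subspace (supported_below n :: (nat \<Rightarrow> dyadic) set)"
    by (auto simp: fun_space.subspace_def supported_below_def)
  show "fun_space.solvable (supported_below n :: (nat \<Rightarrow> dyadic) set) n 0 0 1"
    unfolding fun_space.solvable_def
  proof (intro allI impI, elim conjE)
    fix A\<^sub>1 A\<^sub>2 A\<^sub>3 :: "((nat \<Rightarrow> dyadic) multiset \<Rightarrow> dyadic) set"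
    assume forms: "fun_space.sym_forms 1 A\<^sub>1" "fun_space.sym_forms 2 A\<^sub>2" "fun_space.sym_forms 3 A\<^sub>3"
      and card: "card A\<^sub>1 + 1 \<le> n" "card A\<^sub>2 \<le> 0" "card A\<^sub>3 \<le> 0"
    have empty: "A\<^sub>2 = {}" "A\<^sub>3 = {}"
      using forms card by (auto simp: fun_space.sym_forms_def)
    have "finite A\<^sub>1"
      using forms by (simp add: fun_space.sym_forms_def)
    from homogeneous_system_nontrivial[OF this, of "{..<n}" "\<lambda>M j. M {#\<lambda>i. if i = j then 1 else 0#}"]
    obtain x where x: "\<exists>j<n. x j \<noteq> 0"
      "\<forall>M\<in>A\<^sub>1. (\<Sum>j<n. M {#\<lambda>i. if i = j then 1 else 0#} * x j) = 0"
      using card(1) by auto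
    define y where "y = (\<lambda>i. if i < n then x i else 0)"
    have "M {#y#} = 0" if "M \<in> A\<^sub>1" for M
      using linear_form_expansion[of M n x] that x(2) forms(1) by (simp add: fun_space.sym_forms_def y_def)
    moreover have "y \<noteq> 0"
      using x(1) by (auto simp: y_def fun_eq_iff)
    ultimately show "\<exists>x\<in>supported_below n. x \<noteq> 0 \<and> fun_space.common_zero 1 A\<^sub>1 x \<and>
        fun_space.common_zero 2 A\<^sub>2 x \<and> fun_space.common_zero 3 A\<^sub>3 x"
      by (intro bexI[of _ y]) (auto simp: fun_space.common_zero_def empty supported_below_def y_def)
  qed
qed

theorem theorem3:
  shows "v_form 4 TYPE(2) \<le> 9126"
proof -
  have "\<exists>x. mpoly_eval F x = 0 \<and> (\<exists>i<n. x i \<noteq> 0)" if n: "n > 9126" and F: "is_form 4 n F"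
    for n and F :: "dyadic mpoly"
  proof -
    have "(of_nat (fact 4) :: dyadic) \<noteq> 0"
      by (simp only: of_nat_dyadic_eq_0_iff) simp
    with F obtain M where M: "fun_space.sym_form 4 M" "\<And>x. M (replicate_mset 4 x) = mpoly_eval F x"
      by (rule ex_symmetric_form) blast
    \<comment> \<open>The bound \<open>n > 9126\<close> lies above the 8031 variables required
      here.\<close>
    obtain x where "x \<in> supported_below n" "x \<noteq> 0" "mpoly_eval F x = 0"
      using quartic_zero[OF M(1), of n] n M(2) by auto
    thus ?thesis
      by (intro exI[of _ x]) (auto simp: supported_below_def fun_eq_iff linorder_not_less[symmetric])
  qed
  hence "v_form 4 TYPE(2) \<le> enat 9126"
    unfolding v_form_le_iff_nontrivial_zero by blast
  thus ?thesis
    by (simp add: numeral_eq_enat)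
qed

end
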